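(* Let $n\ge 2$ be an integer and let $BH_n$ be the $n$-dimensional balanced hypercube. Then $BH_n$ is $(2n-2)$-edge-fault-tolerant $6$-edge-bipancyclic; that is, for every set $F\subseteq E(BH_n)$ with $|F|\le 2n-2$, every edge $e\in E(BH_n)\setminus F$, and every even integer $\ell$ with $6\le \ell\le 2^{2n}$, the graph $BH_n-F$ contains a cycle of length $\ell$ passing through $e$.
   Context: The balanced hypercube $BH_n$ ($n\ge 1$) is the simple undirected graph with vertex set $\{0,1,2,3\}^n$ (so $2^{2n}$ vertices), whose vertices are written $(a_0,a_1,\dots,a_{n-1})$. All coordinate arithmetic is modulo $4$. The vertex $(a_0,a_1,\dots,a_{n-1})$ is adjacent to exactly the following $2n$ vertices: (1) $(a_0\pm 1,a_1,\dots,a_{n-1})$; (2) for each $1\le i\le n-1$, $(a_0\pm 1,a_1,\dots,a_{i-1},a_i+(-1)^{a_0},a_{i+1},\dots,a_{n-1})$. The graph $BH_n$ is bipartite, with parts given by the parity of $a_0$. For $F\subseteq E(BH_n)$, $BH_n-F$ is the graph obtained by deleting the edges in $F$ (keeping all vertices). A cycle of length $\ell$ is a cycle with $\ell$ distinct vertices. *)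

theory Defs
  imports Main
begin

text \<open>
  A simple graph is represented as a pair of a vertex set and a set of edges, an edge being the
  two-element set of its end vertices.
\<close>

type_synonym 'a ugraph = "'a set \<times> 'a set set"

abbreviation vertices :: "'a ugraph \<Rightarrow> 'a set" where
  "vertices G \<equiv> fst G"

abbreviation edges :: "'a ugraph \<Rightarrow> 'a set set" where
  "edges G \<equiv> snd G"

definition delete_edges :: "'a ugraph \<Rightarrow> 'a set set \<Rightarrow> 'a ugraph" where
  "delete_edges G F = (vertices G, edges G - F)"

text \<open>
  A cycle is represented by the list of its vertices in cyclic order, without repeating the
  first vertex at the end; its length is thus the length of the list.
\<close>

definition cycle_edges :: "'a list \<Rightarrow> 'a set set" where
  "cycle_edges c = {{c ! i, c ! (Suc i mod length c)} | i. i < length c}"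

definition is_cycle :: "'a ugraph \<Rightarrow> 'a list \<Rightarrow> bool" where
  "is_cycle G c \<longleftrightarrow>
     3 \<le> length c \<and> distinct c \<and> set c \<subseteq> vertices G \<and> cycle_edges c \<subseteq> edges G"

definition BH_vertices :: "nat \<Rightarrow> int list set" where
  "BH_vertices n = {a. length a = n \<and> set a \<subseteq> {0..3}}"

definition BH_neighbours :: "nat \<Rightarrow> int list \<Rightarrow> int list set" where
  "BH_neighbours n a =
     {a[0 := (a ! 0 + s) mod 4] | s. s \<in> {1, - 1}} \<union>
     {a[0 := (a ! 0 + s) mod 4, i := (a ! i + (- 1) ^ nat (a ! 0)) mod 4] | s i.
        s \<in> {1, - 1} \<and> 1 \<le> i \<and> i \<le> n - 1}"

definition BH :: "nat \<Rightarrow> int list ugraph" where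
  "BH n = (BH_vertices n, {{a, b} | a b. a \<in> BH_vertices n \<and> b \<in> BH_neighbours n a})"

end

theory Submission
  imports Defs "HOL-Library.Numeral_Type" "HOL-Library.Disjoint_Sets"
begin

text \<open>
  Two vertices of the balanced hypercube that differ by 2 in \<open>a\<^sub>0\<close> have the same neighbours; they
  are \<^emph>\<open>twins\<close>. Identifying twins leaves a graph whose vertices, here called \<^emph>\<open>cells\<close>, have
  exactly one neighbour in each of the \<open>n\<close> dimensions, and every edge between two cells stands
  for the four edges between the two pairs of twins. With a suitable choice of coordinates (a
  position modulo 4 with coordinate sum 0 or 1, and a step changing one coordinate by one) all
  dimensions play the same role, which the coordinate \<open>a\<^sub>0\<close> of the original description hides.
  Removing the edges of a dimension \<open>j\<close> leaves four copies of the next smaller graph, told apart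
  by the coordinate \<open>j\<close>, so that the theorem can be proved by induction on the set of dimensions
  (\<open>spans_of_few_faults\<close>).

  Let there be \<open>n \<ge> 3\<close> dimensions and at most \<open>2n - 2\<close> faulty edges. By averaging there is a
  dimension \<open>j\<close> such that at most \<open>2n - 4\<close> faults have a dimension other than \<open>j\<close>
  (\<open>light_dimension\<close>), and the induction hypothesis gives all lengths up to \<open>M = 4^(n-1)\<close> inside
  the four copies. Longer cycles are put together along a \<^emph>\<open>ring\<close>: alternating between \<open>j\<close> and a
  second dimension \<open>d\<close> closes up after eight cells, and the ring has exactly one edge of
  dimension \<open>d\<close> in each of the four copies. These four edges can be replaced independently by
  paths with \<open>2, 6, 8, \<dots>, M\<close> vertices inside their copies, which yields every even length from
  12 to \<open>4 M\<close> (\<open>split_length\<close>). It remains to find a ring that the faults do not block. Since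
  twins can be chosen freely along the way, two faults block it only if they are the two
  possible edges at one of its ends (\<open>twin_choice\<close>).

  For an edge of dimension \<open>j\<close> (\<open>linked_across\<close>), the \<open>n - 1\<close> rings through the edge share no
  other edges, so one of them contains at most two faults, of which at most one is not of
  dimension \<open>j\<close>, and is not blocked. Length 6 is too short for a ring and is obtained from
  hexagons in three dimensions by the same count. For an edge of another dimension
  (\<open>linked_along\<close>), take a path with nearly \<open>M\<close> vertices in the copy that contains the edge, and
  detour one of its steps through the three other copies; a weighted count of the faults shows
  that some step can be detoured (\<open>crossable_edge\<close>).

  The induction starts with two dimensions, where the whole graph is a single ring of eight
  pairs of twins and explicit lists of paths suffice (\<open>spans_two\<close>).
\<close>

section \<open>Cells\<close>

text \<open>
  The side of a cell tells whether its coordinate sum is 0 (\<open>False\<close>) or 1 (\<open>True\<close>) in the graph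
  that is being modelled. The sum itself is not imposed: it is preserved relative to the side
  along every edge, so that other sums only contribute disjoint copies of the same graph. A
  vertex is a cell together with a bit that distinguishes the two twins.
\<close>

type_synonym cell = "(nat \<Rightarrow> 4) \<times> bool"
type_synonym vertex = "cell \<times> bool"

text \<open>
  The neighbour in dimension \<open>i\<close>: a step up from side \<open>False\<close> and a step down from side \<open>True\<close>,
  so that taking it twice leads back.
\<close>

definition nb :: "nat \<Rightarrow> cell \<Rightarrow> cell" where
  "nb i y = ((fst y)(i := (if snd y then fst y i - 1 else fst y i + 1)), \<not> snd y)"

definition dim_edges :: "nat set \<Rightarrow> vertex set set" where
  "dim_edges D = {{(y, b), (nb i y, b')} | i y b b'. i \<in> D}"

lemma fst_nb [simp]:
  "fst (nb i y) k = (if k = i then (if snd y then fst y i - 1 else fst y i + 1) else fst y k)"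
  by (simp add: nb_def)

lemma snd_nb [simp]: "snd (nb i y) = (\<not> snd y)"
  by (simp add: nb_def)

lemma nb_nb [simp]: "nb i (nb i y) = y"
  by (cases y) (auto simp: nb_def)

lemma nb_neq [simp]: "nb i y \<noteq> y" "y \<noteq> nb i y"
  by (metis snd_nb)+

lemma nb_inject [simp]: "nb i y = nb i z \<longleftrightarrow> y = z"
  by (metis nb_nb)

lemma nb_dim_inject [simp]: "nb i y = nb j y \<longleftrightarrow> i = j"
proof
  assume "nb i y = nb j y"
  then have "fst (nb i y) i = fst (nb j y) i" by simp
  then show "i = j" by (simp split: if_splits)
qed simp

lemma dim_edgesI [intro]: "i \<in> D \<Longrightarrow> {(y, b), (nb i y, b')} \<in> dim_edges D"
  unfolding dim_edges_def by blast

lemma edge_dim_unique: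
  assumes "{(y, b), (nb i y, b')} = {(z, c), (nb k z, c')}"
  shows "i = k"
proof -
  have "(y = z \<and> nb i y = nb k z) \<or> (y = nb k z \<and> nb i y = z)"
    using assms by (auto simp: doubleton_eq_iff)
  then show ?thesis
  proof
    assume h: "y = nb k z \<and> nb i y = z"
    then have "nb i y = nb k y" by (metis nb_nb)
    then show ?thesis by simp
  qed auto
qed

lemma edge_in_dim_edges_iff [simp]:
  "{(y, b), (nb i y, b')} \<in> dim_edges D \<longleftrightarrow> i \<in> D"
proof
  assume "{(y, b), (nb i y, b')} \<in> dim_edges D"
  then obtain k z c c' where "k \<in> D" "{(y, b), (nb i y, b')} = {(z, c), (nb k z, c')}"
    unfolding dim_edges_def by blast
  then show "i \<in> D" using edge_dim_unique by metis
qed (rule dim_edgesI)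

lemma dim_edges_mono: "D \<subseteq> D' \<Longrightarrow> dim_edges D \<subseteq> dim_edges D'"
  unfolding dim_edges_def by blast

lemma dim_edgeE:
  assumes "{u, v} \<in> dim_edges D"
  obtains i y b b' where "i \<in> D" "u = (y, b)" "v = (nb i y, b')"
proof -
  obtain i y b b' where h: "i \<in> D" "{u, v} = {(y, b), (nb i y, b')}"
    using assms unfolding dim_edges_def by blast
  then consider "u = (y, b) \<and> v = (nb i y, b')" | "v = (y, b) \<and> u = (nb i y, b')"
    by (auto simp: doubleton_eq_iff)
  then show ?thesis
  proof cases
    case 2
    then show ?thesis using that[of i "nb i y" b' b] h by simp
  qed (use that h in blast)
qed

lemma coord_const_edge:
  assumes "{u, v} \<in> dim_edges D" "j \<notin> D"
  shows "fst (fst v) j = fst (fst u) j"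
  using assms by (elim dim_edgeE) auto

section \<open>Walks\<close>

primrec walk :: "(nat \<Rightarrow> nat) \<Rightarrow> cell \<Rightarrow> nat \<Rightarrow> cell" where
  "walk w y 0 = y"
| "walk w y (Suc k) = nb (w k) (walk w y k)"

text \<open>
  One round through the dimensions \<open>a, d\<close> changes the position by \<open>e\<^sub>a - e\<^sub>d\<close> (or its negative),
  which has order 4, so the walk closes up after eight steps; its cell number 7 is therefore the
  \<open>d\<close>-neighbour of the start.
\<close>

definition ring :: "nat \<Rightarrow> nat \<Rightarrow> cell \<Rightarrow> nat \<Rightarrow> cell" where
  "ring a d = walk (\<lambda>k. if even k then a else d)"

lemma snd_walk: "snd (walk w y k) = (snd y \<noteq> odd k)"
  by (induction k) auto

lemma fst_ring:
  assumes "a \<noteq> d"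
  shows "fst (ring a d y k) i =
    (if i = a then fst y a + (if snd y then - of_nat (Suc k div 2) else of_nat (Suc k div 2))
     else if i = d then fst y d - (if snd y then - of_nat (k div 2) else of_nat (k div 2))
     else fst y i)"
  using assms unfolding ring_def by (induction k) (auto simp: snd_walk algebra_simps)

lemma snd_ring: "snd (ring a d y k) = (snd y \<noteq> odd k)"
  by (simp add: ring_def snd_walk)

lemma ring_0 [simp]: "ring a d y 0 = y"
  by (simp add: ring_def)

lemma ring_Suc: "ring a d y (Suc k) = nb (if even k then a else d) (ring a d y k)"
  by (simp add: ring_def)

lemma cell_eqI: "(\<And>i. fst y i = fst z i) \<Longrightarrow> snd y = snd z \<Longrightarrow> y = (z::cell)"
  by (auto simp: prod_eq_iff)

lemma ring_7:
  assumes "a \<noteq> d"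
  shows "ring a d y 7 = nb d y"
  by (rule cell_eqI) (auto simp: fst_ring[OF assms] snd_ring assms)

lemma of_nat_4_inject:
  assumes "a < 4" "b < 4" "of_nat a = (of_nat b :: 4)"
  shows "a = b"
proof -
  have "a \<in> {0, 1, 2, 3}" "b \<in> {0, 1, 2, 3}" using assms(1,2) by auto
  then show ?thesis using assms(3) by auto
qed

lemma inj_on_ring:
  assumes "a \<noteq> d"
  shows "inj_on (ring a d y) {..7}"
proof (rule inj_onI)
  fix k l assume kl: "k \<in> {..7::nat}" "l \<in> {..7::nat}" and eq: "ring a d y k = ring a d y l"
  have "fst (ring a d y k) d = fst (ring a d y l) d" "snd (ring a d y k) = snd (ring a d y l)"
    using eq by simp_all
  then have "of_nat (k div 2) = (of_nat (l div 2) :: 4)" and odd: "odd k = odd l"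
    using assms by (auto simp: fst_ring snd_ring split: if_splits)
  then have "k div 2 = l div 2" using kl by (intro of_nat_4_inject) auto
  then show "k = l" using odd by (metis odd_two_times_div_two_succ even_two_times_div_two)
qed

section \<open>Choosing twins\<close>

text \<open>
  Bits \<open>g 0, \<dots>, g m\<close> with prescribed ends are to be chosen such that no step \<open>(k, g k, g (k +
  1))\<close> is bad. The two choices that are constant in the interior have no step in common, so if
  both fail then one bad step lies on each of them and there are no others. Switching from one
  constant to the other at a place between the two bad steps avoids both. Such a place exists
  unless both bad steps are the first steps or both are the last steps, which is excluded.
\<close>

lemma twin_choice:
  fixes bad :: "(nat \<times> bool \<times> bool) set"
  assumes fin: "finite bad" and two: "card bad \<le> 2" and m: "m \<ge> 3"
    and st: "\<exists>c. (0, b0, c) \<notin> bad" and en: "\<exists>c. (m - 1, c, b1) \<notin> bad"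
  shows "\<exists>g. g 0 = b0 \<and> g m = b1 \<and> (\<forall>k<m. (k, g k, g (Suc k)) \<notin> bad)"
proof (rule ccontr)
  assume no: "\<not> ?thesis"
  \<comment> \<open>Up to place \<open>s\<close> the interior bits are \<open>c\<close>, afterwards they are \<open>\<not> c\<close>; \<open>s = m\<close> gives a constant.\<close>
  define f where "f = (\<lambda>s c k. if k = 0 then b0 else if k = m then b1 else if k \<le> s then c else \<not> c)"
  have f_ends: "f s c 0 = b0" "f s c m = b1" for s c using m by (auto simp: f_def)
  have f_mid: "f s c k \<longleftrightarrow> (if k \<le> s then c else \<not> c)" if "0 < k" "k < m" for s c k
    using that by (simp add: f_def)
  have blk: "\<exists>k<m. (k, f s c k, f s c (Suc k)) \<in> bad" for s c
  proof (rule ccontr)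
    assume "\<not> ?thesis"
    then have "\<forall>k<m. (k, f s c k, f s c (Suc k)) \<notin> bad" by simp
    then show False using no f_ends[of s c] by auto
  qed
  define t where "t = (\<lambda>c p. (p, f m c p, f m c (Suc p)))"
  have t_neq: "(k, f s c k, f s c (Suc k)) \<noteq> t c' p"
    if "x = p \<or> x = Suc p" "0 < x" "x < m" "f s c x \<noteq> c'" for s c c' k p x
    using that f_mid[of x m c'] unfolding t_def by (cases "k = p") auto
  obtain p where p: "p < m" "t True p \<in> bad" using blk[of m True] unfolding t_def by blast
  obtain q where q: "q < m" "t False q \<in> bad" using blk[of m False] unfolding t_def by blast
  have "t True p \<noteq> t False q"
  proof (cases "q = 0")
    case True
    then show ?thesis using t_neq[of 1 q m True False p] f_mid[of 1 m True] m unfolding t_def by auto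
  next
    case False
    then show ?thesis using t_neq[of q q m True False p] f_mid[of q m True] q unfolding t_def by auto
  qed
  then have "card {t True p, t False q} = 2" by simp
  then have bad: "bad = {t True p, t False q}"
    using card_seteq[of bad "{t True p, t False q}"] fin two p q by auto
  have "\<exists>s. 0 < s \<and> s < m - 1 \<and> (p \<le> s \<and> s \<le> q \<or> q \<le> s \<and> s \<le> p)"
  proof (rule ccontr)
    assume no: "\<not> ?thesis"
    have no': "\<not> (p \<le> s \<and> s \<le> q \<or> q \<le> s \<and> s \<le> p)" if "0 < s" "s < m - 1" for s
      using no that by blast
    have "p \<le> q \<or> q \<le> p" by linarith
    then have "p = 0 \<or> p = m - 1" "q = 0 \<or> q = m - 1"
      using no' p(1) q(1) by (smt (verit) le_refl not_gr_zero Suc_diff_1 less_Suc_eq not_less0 nat_le_linear)+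
    moreover have "\<not> (p \<le> 1 \<and> 1 \<le> q \<or> q \<le> 1 \<and> 1 \<le> p)" using no'[of 1] m by linarith
    ultimately consider "p = 0" "q = 0" | "p = m - 1" "q = m - 1" using m by linarith
    then show False
    proof cases
      case 1
      then have "(0, b0, c) \<in> bad" for c using m f_mid[of 1 m] f_ends by (cases c) (auto simp: bad t_def)
      then show False using st by blast
    next
      case 2
      have "Suc (m - 1) = m" using m by simp
      then have "(m - 1, c, b1) \<in> bad" for c using 2 m f_mid[of "m - 1" m] f_ends
        by (cases c) (auto simp: bad t_def)
      then show False using en by blast
    qed
  qed
  then obtain s where s: "0 < s" "s < m - 1" "p \<le> s \<and> s \<le> q \<or> q \<le> s \<and> s \<le> p" by blast
  \<comment> \<open>The bit before the switch is taken from the constant whose bad step lies after the switch.\<close>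
  define c where "c \<longleftrightarrow> \<not> (p \<le> s \<and> s \<le> q)"
  have "\<exists>x. (x = r \<or> x = Suc r) \<and> 0 < x \<and> x \<le> s" if "r \<le> s" for r
    using s(1) that by (cases "r = 0") auto
  moreover have "\<exists>x. (x = r \<or> x = Suc r) \<and> s < x \<and> x < m" if "s \<le> r" "r < m" for r
    using s(2) that by (cases "Suc r = m") auto
  ultimately have "(\<exists>x. (x = p \<or> x = Suc p) \<and> 0 < x \<and> x < m \<and> f s c x \<noteq> True)
    \<and> (\<exists>x. (x = q \<or> x = Suc q) \<and> 0 < x \<and> x < m \<and> f s c x \<noteq> False)"
    using s p(1) q(1) f_mid[of _ s c] unfolding c_def
    by (smt (verit, best) diff_le_self less_trans linorder_not_less order_trans)
  then have "\<forall>k. (k, f s c k, f s c (Suc k)) \<notin> bad"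
    unfolding bad using t_neq by blast
  then show False using blk by blast
qed

definition walk_edge :: "(nat \<Rightarrow> cell) \<Rightarrow> nat \<Rightarrow> bool \<Rightarrow> bool \<Rightarrow> vertex set" where
  "walk_edge r k c c' = {(r k, c), (r (Suc k), c')}"

lemma walk_edge_inject:
  assumes "inj_on r {..m}" "k < m" "k' < m" "walk_edge r k c d = walk_edge r k' c' d'"
  shows "k = k' \<and> c = c' \<and> d = d'"
proof -
  have inj: "r a = r b \<longleftrightarrow> a = b" if "a \<le> m" "b \<le> m" for a b
    using assms(1) that by (auto simp: inj_on_def)
  show ?thesis
    using assms(2-4) by (auto simp: walk_edge_def doubleton_eq_iff inj)
qed

text \<open>
  Only those faults count that the prescribed end bits allow to be met.
\<close>

lemma walk_lift:
  fixes F :: "vertex set set"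
  assumes inj: "inj_on r {..m}" and m: "m \<ge> 3" and fin: "finite F"
    and two: "card {f \<in> F. \<exists>k c c'. k < m \<and> (k = 0 \<longrightarrow> c = b0) \<and> (Suc k = m \<longrightarrow> c' = b1)
                     \<and> f = walk_edge r k c c'} \<le> 2" (is "card ?T \<le> 2")
    and s: "\<exists>c. walk_edge r 0 b0 c \<notin> F" and e: "\<exists>c. walk_edge r (m - 1) c b1 \<notin> F"
  shows "\<exists>g. g 0 = b0 \<and> g m = b1 \<and> (\<forall>k<m. walk_edge r k (g k) (g (Suc k)) \<notin> F)"
proof -
  define bad where "bad = {(k, c, c'). k < m \<and> (k = 0 \<longrightarrow> c = b0) \<and> (Suc k = m \<longrightarrow> c' = b1)
                     \<and> walk_edge r k c c' \<in> F}"
  have sub: "(\<lambda>(k, c, c'). walk_edge r k c c') ` bad \<subseteq> ?T"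
    unfolding bad_def by auto
  have inj': "inj_on (\<lambda>(k, c, c'). walk_edge r k c c') bad"
    by (rule inj_onI) (auto simp: bad_def dest: walk_edge_inject[OF inj])
  have finT: "finite ?T" using fin by simp
  have "finite bad" using inj' sub finT by (meson finite_imageD finite_subset)
  moreover have "card bad \<le> 2" using card_inj_on_le[OF inj' sub finT] two by linarith
  moreover have "\<exists>c. (0, b0, c) \<notin> bad" using s by (auto simp: bad_def)
  moreover have "\<exists>c. (m - 1, c, b1) \<notin> bad" using e by (auto simp: bad_def)
  ultimately obtain g where g: "g 0 = b0" "g m = b1" "\<forall>k<m. (k, g k, g (Suc k)) \<notin> bad"
    using twin_choice[of bad m b0 b1] m by blast
  then have "\<forall>k<m. walk_edge r k (g k) (g (Suc k)) \<notin> F"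
    by (auto simp: bad_def)
  with g show ?thesis by blast
qed

section \<open>Paths\<close>

definition path :: "'a set set \<Rightarrow> 'a list \<Rightarrow> bool" where
  "path A p \<longleftrightarrow> distinct p \<and> successively (\<lambda>u v. {u, v} \<in> A) p"

definition linked :: "'a set set \<Rightarrow> 'a set \<Rightarrow> nat \<Rightarrow> 'a \<Rightarrow> 'a \<Rightarrow> bool" where
  "linked A S k u v \<longleftrightarrow>
     (\<exists>p. p \<noteq> [] \<and> path A p \<and> hd p = u \<and> last p = v \<and> length p = k \<and> set p \<subseteq> S)"

lemma linked_mono:
  assumes "linked A S k u v" "A \<subseteq> A'" "S \<subseteq> S'"
  shows "linked A' S' k u v"
proof -
  have "path A' p" if "path A p" for p
    using that assms(2) unfolding path_def by (auto elim: successively_mono)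
  then show ?thesis using assms(1,3) unfolding linked_def by blast
qed

lemma linked_append:
  assumes "linked A S k u v" "linked A T l x z" "{v, x} \<in> A" "S \<inter> T = {}"
  shows "linked A (S \<union> T) (k + l) u z"
proof -
  obtain p q where "p \<noteq> []" "path A p" "hd p = u" "last p = v" "length p = k" "set p \<subseteq> S"
    "q \<noteq> []" "path A q" "hd q = x" "last q = z" "length q = l" "set q \<subseteq> T"
    using assms(1,2) unfolding linked_def by blast
  then have "path A (p @ q) \<and> hd (p @ q) = u \<and> last (p @ q) = z \<and> length (p @ q) = k + l
      \<and> set (p @ q) \<subseteq> S \<union> T"
    using assms(3,4) by (auto simp: path_def successively_append_iff)
  then show ?thesis unfolding linked_def using \<open>p \<noteq> []\<close> by blast
qed

lemma linked_2: "{u, v} \<in> A \<Longrightarrow> u \<noteq> v \<Longrightarrow> {u, v} \<subseteq> S \<Longrightarrow> linked A S 2 u v"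
  unfolding linked_def by (rule exI[of _ "[u, v]"]) (auto simp: path_def)

text \<open>
  The step from \<open>p ! i\<close> to \<open>p ! Suc i\<close> is replaced by a detour through \<open>T\<close>.
\<close>

lemma linked_insert:
  assumes p: "path A p" "set p \<subseteq> S" and i: "Suc i < length p"
    and q: "linked A T k x z" "S \<inter> T = {}" and e: "{p ! i, x} \<in> A" "{z, p ! Suc i} \<in> A"
  shows "linked A (S \<union> T) (length p + k) (hd p) (last p)"
proof -
  obtain p1 p2 where pe: "p = p1 @ p2" and l1: "length p1 = Suc i"
    using i by (metis append_take_drop_id length_take min.absorb4)
  have ne: "p1 \<noteq> []" "p2 \<noteq> []" using i l1 pe by auto
  have l: "last p1 = p ! i" "hd p2 = p ! Suc i"
    using ne l1 by (simp_all add: pe last_conv_nth hd_conv_nth nth_append)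
  obtain q' where q': "q' \<noteq> []" "path A q'" "hd q' = x" "last q' = z" "length q' = k" "set q' \<subseteq> T"
    using q(1) unfolding linked_def by blast
  have "set p1 \<inter> set q' = {}" "set p2 \<inter> set q' = {}" using p(2) q(2) q'(6) pe by auto
  then have "path A (p1 @ q' @ p2)"
    using p(1) q' e ne unfolding path_def pe
    by (auto simp: successively_append_iff l[unfolded pe])
  moreover have "hd (p1 @ q' @ p2) = hd p" "last (p1 @ q' @ p2) = last p"
    "length (p1 @ q' @ p2) = length p + k" "set (p1 @ q' @ p2) \<subseteq> S \<union> T"
    using ne pe q' p(2) by auto
  ultimately show ?thesis unfolding linked_def using ne by blast
qed

text \<open>
  The levels of a coordinate \<open>j\<close> are the copies into which the graph falls when the edges of
  dimension \<open>j\<close> are removed; distinct levels keep partial paths disjoint.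
\<close>

definition level :: "nat \<Rightarrow> 4 \<Rightarrow> vertex set" where
  "level j a = {w. fst (fst w) j = a}"

lemma path_level:
  assumes "path A p" "A \<subseteq> dim_edges D" "j \<notin> D" "p \<noteq> []"
  shows "set p \<subseteq> level j (fst (fst (hd p)) j)"
proof -
  have "successively (\<lambda>u v. {u, v} \<in> A) p \<Longrightarrow> p \<noteq> [] \<Longrightarrow> \<forall>w \<in> set p. fst (fst w) j = fst (fst (hd p)) j"
  proof (induction p)
    case (Cons u p)
    show ?case
    proof (cases p)
      case (Cons v q)
      then have "{u, v} \<in> dim_edges D" using Cons.prems assms(2) by auto
      then have "fst (fst v) j = fst (fst u) j" using coord_const_edge assms(3) by blast
      then show ?thesis using Cons.IH Cons.prems Cons by auto
    qed simp
  qed simp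
  then show ?thesis using assms unfolding path_def level_def by blast
qed

lemma linked_level:
  assumes "linked A S k u v" "A \<subseteq> dim_edges D" "j \<notin> D"
  shows "linked A (level j (fst (fst u) j)) k u v"
  using assms path_level unfolding linked_def by metis

text \<open>
  A cycle of length \<open>l\<close> through an edge is a path with \<open>l\<close> vertices joining the ends of the
  edge. As the path has at least six vertices it does not use the edge itself.
\<close>

definition spans :: "nat set \<Rightarrow> vertex set set \<Rightarrow> bool" where
  "spans D F \<longleftrightarrow> (\<forall>i \<in> D. \<forall>y b b' l. even l \<and> 6 \<le> l \<and> l \<le> 4 ^ card D \<longrightarrow>
     linked (dim_edges D - F) UNIV l (y, b) (nb i y, b'))"

section \<open>Dimension two\<close>

text \<open>
  The ring of eight pairs of twins is coded by the numbers below 16: the vertex \<open>2 k + c\<close> is the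
  twin \<open>c\<close> of cell \<open>k\<close>. A step is recorded as an ordered pair so that both directions of an edge
  give the same record.
\<close>

definition path_steps :: "nat list \<Rightarrow> (nat \<times> nat) list" where
  "path_steps p = map (\<lambda>(a, b). (min a b, max a b)) (zip p (tl p))"

definition ring_adjacent :: "nat \<Rightarrow> nat \<Rightarrow> bool" where
  "ring_adjacent a b \<longleftrightarrow> b div 2 = Suc (a div 2) mod 8 \<or> a div 2 = Suc (b div 2) mod 8"

text \<open>
  The edge to be closed up joins the cells 0 and 7; renaming twins makes its ends the vertices 0
  and 14.
\<close>

definition ring_path :: "nat list \<Rightarrow> bool" where
  "ring_path p \<longleftrightarrow> hd p = 0 \<and> last p = 14 \<and> distinct p \<and> (\<forall>a \<in> set p. a < 16)
     \<and> (\<forall>(a, b) \<in> set (path_steps p). ring_adjacent a b)"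

text \<open>
  A finitely checkable form of the property that no two edges together meet all paths in \<open>P\<close>: an
  adversary has to choose a first edge \<open>f\<close> on \<open>p\<close> and a second edge \<open>g\<close> on some path \<open>q\<close> that
  avoids \<open>f\<close>, and then still misses a path.
\<close>

definition unhit_by_two :: "nat list list \<Rightarrow> bool" where
  "unhit_by_two P \<longleftrightarrow> (\<exists>p \<in> set P. \<forall>f \<in> set (path_steps p).
     \<exists>q \<in> set P. f \<notin> set (path_steps q) \<and> (\<forall>g \<in> set (path_steps q).
       \<exists>s \<in> set P. f \<notin> set (path_steps s) \<and> g \<notin> set (path_steps s)))"

lemma unhit_by_twoD:
  assumes "unhit_by_two P" "finite B" "card B \<le> 2"
  shows "\<exists>p \<in> set P. set (path_steps p) \<inter> B = {}"
proof (rule ccontr)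
  assume no: "\<not> ?thesis"
  obtain p where p: "p \<in> set P" "\<And>f. f \<in> set (path_steps p) \<Longrightarrow>
     \<exists>q \<in> set P. f \<notin> set (path_steps q) \<and> (\<forall>g \<in> set (path_steps q).
       \<exists>s \<in> set P. f \<notin> set (path_steps s) \<and> g \<notin> set (path_steps s))"
    using assms(1) unfolding unhit_by_two_def by blast
  obtain f where f: "f \<in> set (path_steps p)" "f \<in> B" using no p(1) by blast
  obtain q where q: "q \<in> set P" "f \<notin> set (path_steps q)" "\<And>g. g \<in> set (path_steps q) \<Longrightarrow>
       \<exists>s \<in> set P. f \<notin> set (path_steps s) \<and> g \<notin> set (path_steps s)"
    using p(2)[OF f(1)] by blast
  obtain g where g: "g \<in> set (path_steps q)" "g \<in> B" using no q(1) by blast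
  have "f \<noteq> g" using q(2) g(1) by blast
  then have "B = {f, g}"
    using card_seteq[of B "{f, g}"] assms(2,3) f(2) g(2) by auto
  moreover obtain s where "s \<in> set P" "f \<notin> set (path_steps s)" "g \<notin> set (path_steps s)"
    using q(3)[OF g(1)] by blast
  ultimately show False using no by blast
qed

text \<open>
  For each of the lengths 6, 8, 10, 12, 14, 16 a family of paths from 0 to 14, found by a greedy
  search. Three pairwise disjoint paths would be simpler, but with 12 or more vertices they
  would need more than the 32 edges of the graph.
\<close>

definition detours :: "nat list list list" where
  "detours =
   [[[0, 3, 5, 2, 1, 14],
     [0, 15, 13, 11, 12, 14],
     [0, 15, 12, 10, 13, 14],
     [0, 2, 1, 15, 12, 14],
     [0, 3, 1, 15, 13, 14]],
    [[0, 3, 5, 6, 4, 2, 1, 14],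
     [0, 2, 5, 7, 8, 10, 13, 14],
     [0, 15, 13, 11, 9, 10, 12, 14]],
    [[0, 3, 5, 6, 8, 7, 9, 11, 12, 14],
     [0, 2, 4, 3, 1, 15, 12, 10, 13, 14],
     [0, 15, 13, 11, 8, 7, 5, 2, 1, 14],
     [0, 3, 5, 7, 4, 6, 8, 11, 12, 14]],
    [[0, 3, 5, 7, 9, 10, 8, 11, 13, 15, 1, 14],
     [0, 2, 4, 7, 8, 6, 9, 11, 12, 10, 13, 14],
     [0, 3, 1, 2, 5, 6, 4, 7, 8, 11, 12, 14],
     [0, 15, 12, 10, 8, 6, 5, 2, 4, 3, 1, 14],
     [0, 15, 1, 2, 5, 3, 4, 6, 9, 11, 13, 14]],
    [[0, 3, 5, 7, 4, 6, 8, 10, 9, 11, 12, 15, 1, 14],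
     [0, 2, 4, 3, 5, 6, 9, 7, 8, 11, 13, 10, 12, 14],
     [0, 3, 1, 2, 5, 6, 4, 7, 8, 10, 12, 15, 13, 14],
     [0, 15, 1, 3, 4, 2, 5, 7, 9, 6, 8, 11, 13, 14],
     [0, 15, 1, 3, 5, 7, 8, 6, 9, 11, 12, 10, 13, 14],
     [0, 15, 13, 10, 8, 11, 9, 7, 4, 3, 5, 2, 1, 14],
     [0, 2, 4, 6, 5, 7, 8, 11, 9, 10, 13, 15, 12, 14]],
    [[0, 15, 13, 11, 8, 7, 5, 3, 1, 2, 4, 6, 9, 10, 12, 14],
     [0, 2, 1, 15, 12, 11, 9, 7, 4, 3, 5, 6, 8, 10, 13, 14],
     [0, 3, 4, 2, 5, 6, 9, 7, 8, 11, 13, 10, 12, 15, 1, 14],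
     [0, 3, 1, 2, 5, 7, 4, 6, 8, 10, 9, 11, 13, 15, 12, 14],
     [0, 2, 5, 7, 9, 10, 13, 15, 1, 3, 4, 6, 8, 11, 12, 14],
     [0, 3, 5, 6, 9, 11, 12, 10, 8, 7, 4, 2, 1, 15, 13, 14],
     [0, 15, 12, 10, 13, 11, 9, 6, 8, 7, 4, 2, 5, 3, 1, 14],
     [0, 15, 12, 11, 13, 10, 8, 7, 9, 6, 4, 3, 5, 2, 1, 14],
     [0, 3, 1, 2, 4, 6, 5, 7, 9, 11, 8, 10, 12, 15, 13, 14],
     [0, 2, 4, 7, 5, 3, 1, 15, 12, 10, 8, 6, 9, 11, 13, 14],
     [0, 15, 1, 2, 4, 3, 5, 7, 8, 6, 9, 10, 12, 11, 13, 14]]]"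

lemma detours_unhit: "\<forall>P \<in> set detours. unhit_by_two P"
  by code_simp

lemma detours_ring_path: "\<forall>k \<in> set [0..<6]. \<forall>p \<in> set (detours ! k). ring_path p \<and> length p = 2 * k + 6"
  by code_simp

lemma successively_path_steps:
  assumes "\<forall>(a, b) \<in> set (path_steps p). P a b" "\<And>a b. P a b \<Longrightarrow> P b a"
  shows "successively P p"
  unfolding successively_conv_nth
proof (intro allI impI)
  fix k assume k: "Suc k < length p"
  let ?a = "p ! k" and ?b = "p ! Suc k"
  have "(?a, ?b) \<in> set (zip p (tl p))"
    using k by (auto simp: set_zip nth_tl intro!: exI[of _ k])
  then have "(min ?a ?b, max ?a ?b) \<in> set (path_steps p)"
    unfolding path_steps_def by force
  then have "P (min ?a ?b) (max ?a ?b)" using assms(1) by blast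
  then show "P ?a ?b" using assms(2) by (cases "?a \<le> ?b") (auto simp: min_def max_def)
qed

lemma length_detours: "length detours = 6"
  by (simp add: detours_def)

text \<open>
  The ring starting at \<open>y\<close> ends at \<open>nb i y\<close> and contains all cells reachable in two dimensions.
  The listed paths are transported to it, with twins exchanged in the two end cells as the given
  end bits require.
\<close>

lemma spans_two:
  assumes fin: "finite F" and D: "card D = 2" and two: "card (F \<inter> dim_edges D) \<le> 2"
  shows "spans D F"
  unfolding spans_def
proof (intro ballI allI impI)
  fix i y b b' and l :: nat
  assume i: "i \<in> D" and l: "even l \<and> 6 \<le> l \<and> l \<le> 4 ^ card D"
  obtain d where d: "d \<noteq> i" "D = {i, d}"
    using D i by (metis card_2_iff doubleton_eq_iff insertE singletonD)
  define r where "r = ring d i y"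
  have r_inj: "r k = r k' \<longleftrightarrow> k = k'" if "k \<le> 7" "k' \<le> 7" for k k'
    using inj_on_ring[OF d(1), of y] that unfolding r_def inj_on_def by auto
  have r_ends: "r 0 = y" "r 7 = nb i y" using ring_7[OF d(1)] by (simp_all add: r_def)
  define t where "t = (\<lambda>k::nat. if k = 0 then b else if k = 7 then b' else False)"
  define h where "h = (\<lambda>v. (r (v div 2), odd v \<noteq> t (v div 2)))"
  have h_inj: "v = v'" if "v < 16" "v' < 16" "h v = h v'" for v v'
  proof -
    have "v div 2 = v' div 2" "odd v = odd v'"
      using that r_inj[of "v div 2" "v' div 2"] unfolding h_def by auto
    then show ?thesis by (metis odd_two_times_div_two_succ even_two_times_div_two)
  qed
  have step: "{h u, h v} \<in> dim_edges D" if "u < 16" "v div 2 = Suc (u div 2) mod 8" for u v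
  proof (cases "u div 2 = 7")
    case True
    then have "h u = (nb i y, odd u \<noteq> t 7)" "h v = (y, odd v \<noteq> t 0)"
      using that by (simp_all add: h_def r_ends)
    then have "{h u, h v} = {(y, odd v \<noteq> t 0), (nb i y, odd u \<noteq> t 7)}" by auto
    then show ?thesis using i by simp
  next
    case False
    then have "v div 2 = Suc (u div 2)" using that by auto
    then have "r (v div 2) = nb (if even (u div 2) then d else i) (r (u div 2))"
      by (simp add: r_def ring_Suc)
    then show ?thesis unfolding h_def by (simp add: d(2))
  qed
  have step': "{h u, h v} \<in> dim_edges D" if "u < 16" "v < 16" "ring_adjacent u v" for u v
    using that step[of u v] step[of v u] unfolding ring_adjacent_def by (auto simp: insert_commute)
  define B where "B = {(u, v). u < v \<and> v < 16 \<and> ring_adjacent u v \<and> {h u, h v} \<in> F}"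
  have "(\<lambda>(u, v). {h u, h v}) ` B \<subseteq> F \<inter> dim_edges D"
    using step' unfolding B_def by auto
  moreover have "inj_on (\<lambda>(u, v). {h u, h v}) B"
  proof (rule inj_onI, clarify)
    fix u v u' v' assume uv: "(u, v) \<in> B" "(u', v') \<in> B" "{h u, h v} = {h u', h v'}"
    have lt: "u < v" "v < 16" "u' < v'" "v' < 16" using uv unfolding B_def by auto
    have "h u = h u' \<and> h v = h v' \<or> h u = h v' \<and> h v = h u'"
      using uv(3) by (auto simp: doubleton_eq_iff)
    then show "u = u' \<and> v = v'"
      using h_inj[of u u'] h_inj[of v v'] h_inj[of u v'] h_inj[of v u'] lt by auto
  qed
  ultimately have "card B \<le> 2"
    using card_inj_on_le[of _ B "F \<inter> dim_edges D"] fin two by (meson finite_Int le_trans)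
  moreover have "finite B"
    by (rule finite_subset[of _ "{..<16} \<times> {..<16}"]) (auto simp: B_def)
  moreover
  define k where "k = l div 2 - 3"
  have "even l" "6 \<le> l" "l \<le> 16" using l D by (simp_all add: power2_eq_square)
  then have k: "l = 2 * k + 6" "k < 6" unfolding k_def by presburger+
  have "unhit_by_two (detours ! k)"
    using detours_unhit k(2) nth_mem[of k detours] by (simp add: length_detours)
  ultimately obtain p where p: "p \<in> set (detours ! k)" "set (path_steps p) \<inter> B = {}"
    using unhit_by_twoD by blast
  have rp: "ring_path p" "length p = l" using detours_ring_path k p(1) by auto
  then have p16: "\<forall>a \<in> set p. a < 16" and dist: "distinct p" and ends: "hd p = 0" "last p = 14"
    unfolding ring_path_def by auto
  have ne: "p \<noteq> []" using rp l by auto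
  have "successively (\<lambda>a b. {h a, h b} \<in> dim_edges D - F) p"
  proof (rule successively_path_steps)
    show "\<forall>(u, v) \<in> set (path_steps p). {h u, h v} \<in> dim_edges D - F"
    proof clarify
      fix u v assume uv: "(u, v) \<in> set (path_steps p)"
      then obtain a c where ac: "(a, c) \<in> set (zip p (tl p))" "u = min a c" "v = max a c"
        unfolding path_steps_def by auto
      have "a \<in> set p" "c \<in> set p" using ac(1) ne by (auto dest: set_zip_leftD set_zip_rightD list.set_sel(2))
      then have lt: "u < 16" "v < 16" using p16 ac by auto
      have adj: "ring_adjacent u v" using rp uv unfolding ring_path_def by auto
      have div_less_8: "u div 2 < 8" using lt by simp
      have "Suc k mod 8 \<noteq> k" if "k < 8" for k :: nat
        using that by (cases "k = 7") auto
      then have "u \<noteq> v" using adj div_less_8 unfolding ring_adjacent_def by metis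
      then have "u < v" using ac by auto
      then have "{h u, h v} \<notin> F" using p(2) uv lt adj unfolding B_def by auto
      then show "{h u, h v} \<in> dim_edges D - F" using step' lt adj by blast
    qed
  qed (simp add: insert_commute)
  then have "path (dim_edges D - F) (map h p)"
    using dist p16 h_inj unfolding path_def
    by (auto simp: successively_map distinct_map inj_on_def)
  moreover have "hd (map h p) = (y, b)" "last (map h p) = (nb i y, b')"
    using ne ends by (simp_all add: hd_map last_map h_def t_def r_ends)
  ultimately show "linked (dim_edges D - F) UNIV l (y, b) (nb i y, b')"
    unfolding linked_def using rp ne by (intro exI[of _ "map h p"]) auto
qed

section \<open>Chains of segments in a ring\<close>

lemma linked_chain:
  assumes "n > 0"
    and seg: "\<And>i. i < n \<Longrightarrow> linked A (S i) (k i) (u i) (v i)"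
    and link: "\<And>i. Suc i < n \<Longrightarrow> {v i, u (Suc i)} \<in> A"
    and disj: "\<And>i i'. i < n \<Longrightarrow> i' < n \<Longrightarrow> i \<noteq> i' \<Longrightarrow> S i \<inter> S i' = {}"
  shows "linked A (\<Union>i<n. S i) (\<Sum>i<n. k i) (u 0) (v (n - 1))"
proof -
  have "m < n \<Longrightarrow> linked A (\<Union>i<Suc m. S i) (\<Sum>i<Suc m. k i) (u 0) (v m)" for m
  proof (induction m)
    case 0
    then show ?case using seg[of 0] assms(1) by (simp add: lessThan_Suc)
  next
    case (Suc m)
    have "S i \<inter> S (Suc m) = {}" if "i < Suc m" for i
      using disj[of i "Suc m"] that Suc.prems by auto
    then have "(\<Union>i<Suc m. S i) \<inter> S (Suc m) = {}" by blast
    then have "linked A ((\<Union>i<Suc m. S i) \<union> S (Suc m)) ((\<Sum>i<Suc m. k i) + k (Suc m)) (u 0) (v (Suc m))"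
      using linked_append Suc.IH Suc.prems seg link by (metis Suc_lessD)
    moreover have "(\<Union>i<Suc (Suc m). S i) = (\<Union>i<Suc m. S i) \<union> S (Suc m)"
      by (auto simp: less_Suc_eq)
    ultimately show ?case by simp
  qed
  from this[of "n - 1"] show ?thesis using assms(1) by simp
qed

text \<open>
  One step of dimension \<open>d\<close> may stay as it is or be expanded inside its level, by induction
  hypothesis.
\<close>

lemma segment:
  assumes "spans D F" "d \<in> D" "j \<notin> D"
    and "k = 2 \<and> {(y, b), (nb d y, b')} \<notin> F \<or> even k \<and> 6 \<le> k \<and> k \<le> 4 ^ card D"
  shows "linked (dim_edges D - F) (level j (fst y j)) k (y, b) (nb d y, b')"
proof -
  have "linked (dim_edges D - F) UNIV k (y, b) (nb d y, b')"
    using assms(4)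
  proof
    assume "k = 2 \<and> {(y, b), (nb d y, b')} \<notin> F"
    then show ?thesis using linked_2[of "(y, b)" "(nb d y, b')"] assms(2) by simp
  next
    assume "even k \<and> 6 \<le> k \<and> k \<le> 4 ^ card D"
    then show ?thesis using assms(1,2) unfolding spans_def by blast
  qed
  from linked_level[OF this, of D j] show ?thesis using assms(3) by auto
qed

lemma level_disjoint: "a \<noteq> b \<Longrightarrow> level j a \<inter> level j b = {}"
  by (auto simp: level_def)

lemma ring_pair:
  "ring d j z (2 * i + 1) = nb d (ring d j z (2 * i))"
  "ring d j z (2 * i + 2) = nb j (ring d j z (2 * i + 1))"
  by (simp_all add: ring_def)

text \<open>
  Every second step of the ring has dimension \<open>d\<close> and stays in a level of \<open>j\<close>; the steps between
  them lead to the next of the four levels. Hence the \<open>d\<close>-steps can be expanded independently.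
\<close>

lemma linked_ring_segments:
  assumes "d \<noteq> j" "0 < n" "n \<le> 4" "j \<in> D"
    and seg: "\<And>i. i < n \<Longrightarrow> linked (dim_edges D - F) (level j (fst (ring d j z (2 * i)) j)) (k i)
        (ring d j z (2 * i), g (2 * i)) (ring d j z (2 * i + 1), g (2 * i + 1))"
    and ok: "\<And>i. Suc i < n \<Longrightarrow> walk_edge (ring d j z) (2 * i + 1) (g (2 * i + 1)) (g (2 * i + 2)) \<notin> F"
  shows "linked (dim_edges D - F) (\<Union>i<n. level j (fst (ring d j z (2 * i)) j)) (\<Sum>i<n. k i)
      (z, g 0) (ring d j z (2 * n - 1), g (2 * n - 1))"
proof -
  let ?r = "ring d j z"
  have "linked (dim_edges D - F) (\<Union>i<n. level j (fst (?r (2 * i)) j)) (\<Sum>i<n. k i)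
      ((\<lambda>i. (?r (2 * i), g (2 * i))) 0) ((\<lambda>i. (?r (2 * i + 1), g (2 * i + 1))) (n - 1))"
  proof (rule linked_chain[OF assms(2) seg])
    fix i assume i: "Suc i < n"
    have "{(?r (2 * i + 1), g (2 * i + 1)), (?r (2 * i + 2), g (2 * i + 2))} \<in> dim_edges D"
      unfolding ring_pair(2) using assms(4) by simp
    then show "{(?r (2 * i + 1), g (2 * i + 1)), (?r (2 * Suc i), g (2 * Suc i))} \<in> dim_edges D - F"
      using ok[OF i] by (simp add: walk_edge_def)
  next
    fix i i' assume i: "i < n" "i' < n" "i \<noteq> i'"
    then have "(of_nat i :: 4) \<noteq> of_nat i'" using of_nat_4_inject[of i i'] assms(3) by auto
    then have "fst (?r (2 * i)) j \<noteq> fst (?r (2 * i')) j"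
      using assms(1) by (simp add: fst_ring)
    then show "level j (fst (?r (2 * i)) j) \<inter> level j (fst (?r (2 * i')) j) = {}"
      by (rule level_disjoint)
  qed
  moreover have "2 * (n - 1) + 1 = 2 * n - 1" using assms(2) by simp
  ultimately show ?thesis by simp
qed

section \<open>Distributing the length\<close>

text \<open>
  The lengths of the four segments. Four vertices are not available for a segment, since a path
  with four vertices need not exist around faults. When \<open>l\<close> exceeds \<open>M\<close>, the first segment can
  be kept within 4 of the maximum, which \<open>crossable_edge\<close> relies on.
\<close>

lemma split_length:
  fixes M l :: nat
  assumes "even M" "16 \<le> M" "even l" "12 \<le> l" "l \<le> 4 * M"
  shows "\<exists>k0 k1 k2 k3. l = k0 + k1 + k2 + k3
    \<and> even k0 \<and> 6 \<le> k0 \<and> k0 \<le> M \<and> (M < l \<longrightarrow> M \<le> k0 + 4)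
    \<and> (\<forall>k \<in> {k1, k2, k3}. k = 2 \<or> even k \<and> 6 \<le> k \<and> k \<le> M)"
proof -
  have pair: "\<exists>k k'. t = k + k' \<and> even k \<and> even k' \<and> 6 \<le> k' \<and> k' \<le> M \<and> M \<le> k + 2 \<and> k \<le> M"
    if t: "even t" "M + 4 \<le> t" "t \<le> 2 * M" for t
  proof (cases "t = M + 4")
    case True
    then show ?thesis using assms by (intro exI[of _ "M - 2"] exI[of _ 6]) auto
  next
    case False
    then have "M + 6 \<le> t" using t assms(1) by presburger
    then show ?thesis using assms t by (intro exI[of _ M] exI[of _ "t - M"]) auto
  qed
  have "l \<le> M + 6 \<or> M + 8 \<le> l \<and> l \<le> 2 * M + 4 \<or> 2 * M + 6 \<le> l \<and> l \<le> 3 * M + 2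
      \<or> 3 * M + 4 \<le> l"
    using assms(1,3) by presburger
  then consider "l \<le> M + 6" | "M + 8 \<le> l" "l \<le> 2 * M + 4" | "2 * M + 6 \<le> l" "l \<le> 3 * M + 2"
    | "3 * M + 4 \<le> l"
    by blast
  then show ?thesis
  proof cases
    case 1
    have "M + 2 \<le> l" if "M < l" using that assms(1,3) by presburger
    then show ?thesis using 1 assms by (intro exI[of _ "l - 6"] exI[of _ 2] exI[of _ 2] exI[of _ 2]) auto
  next
    case 2
    then have t: "even (l - 4)" "M + 4 \<le> l - 4" "l - 4 \<le> 2 * M"
      using assms by auto
    obtain k k' where "l - 4 = k + k'" "even k" "even k'" "6 \<le> k'" "k' \<le> M" "M \<le> k + 2" "k \<le> M"
      using pair[OF t] by blast
    then show ?thesis using 2 assms by (intro exI[of _ k] exI[of _ k'] exI[of _ 2] exI[of _ 2]) auto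
  next
    case 3
    then have t: "even (l - M - 2)" "M + 4 \<le> l - M - 2" "l - M - 2 \<le> 2 * M"
      using assms by auto
    obtain k k' where "l - M - 2 = k + k'" "even k" "even k'" "6 \<le> k'" "k' \<le> M" "M \<le> k + 2" "k \<le> M"
      using pair[OF t] by blast
    then show ?thesis using 3 assms by (intro exI[of _ M] exI[of _ k] exI[of _ k'] exI[of _ 2]) auto
  next
    case 4
    then have t: "even (l - 2 * M)" "M + 4 \<le> l - 2 * M" "l - 2 * M \<le> 2 * M"
      using assms by auto
    obtain k k' where "l - 2 * M = k + k'" "even k" "even k'" "6 \<le> k'" "k' \<le> M" "M \<le> k + 2" "k \<le> M"
      using pair[OF t] by blast
    then show ?thesis using 4 assms by (intro exI[of _ M] exI[of _ M] exI[of _ k] exI[of _ k']) auto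
  qed
qed

section \<open>Sparse members of a disjoint family\<close>

text \<open>
  If each \<open>R d\<close> had three elements of \<open>X\<close> or two elements of \<open>Y \<subseteq> X\<close>, each would have at least
  two of \<open>X\<close>. Since \<open>X\<close> has at most twice as many elements as \<open>I\<close>, each would have exactly two,
  so both would be in \<open>Y\<close>, which is too small for that. It will be applied to all faults \<open>X\<close> and
  the faults \<open>Y\<close> outside the dimension that splits the graph.
\<close>

lemma sparse_member:
  fixes R :: "'i \<Rightarrow> 'a set"
  assumes "finite I" "disjoint_family_on R I" "finite X" "Y \<subseteq> X"
    and X: "card X \<le> 2 * card I" and Y: "card Y < 2 * card I"
  shows "\<exists>d \<in> I. card (X \<inter> R d) \<le> 2 \<and> card (Y \<inter> R d) \<le> 1"
proof (rule ccontr)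
  assume no: "\<not> ?thesis"
  have finY: "finite Y" using assms(3,4) by (rule rev_finite_subset)
  have total: "(\<Sum>d\<in>I. card (Z \<inter> R d)) \<le> card Z" if "finite Z" for Z
  proof -
    have "(\<Sum>d\<in>I. card (Z \<inter> R d)) = card (\<Union>d\<in>I. Z \<inter> R d)"
      using that assms(1,2) by (intro card_UN_disjoint[symmetric]) (auto simp: disjoint_family_on_def)
    also have "\<dots> \<le> card Z" using that by (intro card_mono) auto
    finally show ?thesis .
  qed
  have le: "card (Y \<inter> R d) \<le> card (X \<inter> R d)" for d
    using assms(3,4) by (intro card_mono) auto
  have ge2: "2 \<le> card (X \<inter> R d)" if "d \<in> I" for d
    using no that le[of d] by fastforce
  have le2: "card (X \<inter> R d) \<le> 2" if d: "d \<in> I" for d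
  proof (rule ccontr)
    assume "\<not> card (X \<inter> R d) \<le> 2"
    then have "(\<Sum>d\<in>I. 2) < (\<Sum>d\<in>I. card (X \<inter> R d))"
      using assms(1) d ge2 by (intro sum_strict_mono_ex1) (auto intro!: bexI[of _ d])
    then show False using total[OF assms(3)] X by simp
  qed
  have "(\<Sum>d\<in>I. 2) \<le> (\<Sum>d\<in>I. card (Y \<inter> R d))"
    using no le2 by (intro sum_mono) fastforce
  then show False using total[OF finY] Y by simp
qed

definition walk_edges :: "(nat \<Rightarrow> cell) \<Rightarrow> nat \<Rightarrow> vertex set set" where
  "walk_edges r m = {walk_edge r k c c' | k c c'. k < m}"

lemma walk_edge_dim [simp]: "walk_edge (walk w z) k c c' \<in> dim_edges D \<longleftrightarrow> w k \<in> D"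
  by (simp add: walk_edge_def)

lemma card_twins_ge_2:
  assumes "finite X" "\<And>c::bool. f c \<in> X" "f True \<noteq> f False"
  shows "2 \<le> card X"
proof -
  have "{f True, f False} \<subseteq> X" using assms(2) by auto
  from card_mono[OF assms(1) this] show ?thesis using assms(3) by simp
qed

text \<open>
  The first and the last step have dimensions in \<open>D\<close>, and one fault in these dimensions cannot
  block both twins at an end.
\<close>

lemma sparse_walk_lift:
  assumes inj: "inj_on (walk w z) {..m}" and m: "m \<ge> 3" and fin: "finite F"
    and two: "card (F \<inter> walk_edges (walk w z) m) \<le> 2"
    and one: "card (F \<inter> walk_edges (walk w z) m \<inter> dim_edges D) \<le> 1"
    and ends: "w 0 \<in> D" "w (m - 1) \<in> D"
  shows "\<exists>g. g 0 = b0 \<and> g m = b1 \<and> (\<forall>k<m. walk_edge (walk w z) k (g k) (g (Suc k)) \<notin> F)"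
proof (rule walk_lift[OF inj m fin])
  let ?r = "walk w z"
  show "card {f \<in> F. \<exists>k c c'. k < m \<and> (k = 0 \<longrightarrow> c = b0) \<and> (Suc k = m \<longrightarrow> c' = b1)
      \<and> f = walk_edge ?r k c c'} \<le> 2"
    using fin by (intro order_trans[OF card_mono two]) (auto simp: walk_edges_def)
  have fin': "finite (F \<inter> walk_edges ?r m \<inter> dim_edges D)" using fin by simp
  show "\<exists>c. walk_edge ?r 0 b0 c \<notin> F"
  proof (rule ccontr)
    assume "\<not> ?thesis"
    then have "walk_edge ?r 0 b0 c \<in> F \<inter> walk_edges ?r m \<inter> dim_edges D" for c
      using ends m unfolding walk_edges_def by fastforce
    moreover have "walk_edge ?r 0 b0 True \<noteq> walk_edge ?r 0 b0 False"
      using walk_edge_inject[OF inj, of 0 0 b0 True b0 False] m by auto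
    ultimately show False using card_twins_ge_2[OF fin', of "walk_edge ?r 0 b0"] one by simp
  qed
  show "\<exists>c. walk_edge ?r (m - 1) c b1 \<notin> F"
  proof (rule ccontr)
    assume "\<not> ?thesis"
    then have "walk_edge ?r (m - 1) c b1 \<in> F \<inter> walk_edges ?r m \<inter> dim_edges D" for c
      using ends m unfolding walk_edges_def by fastforce
    moreover have "walk_edge ?r (m - 1) True b1 \<noteq> walk_edge ?r (m - 1) False b1"
      using walk_edge_inject[OF inj, of "m - 1" "m - 1" True b1 False b1] m by auto
    ultimately show False using card_twins_ge_2[OF fin', of "\<lambda>c. walk_edge ?r (m - 1) c b1"] one by simp
  qed
qed

section \<open>Edges of the splitting dimension\<close>

text \<open>
  Around one fault-free edge of cells: over and back through the other twins.
\<close>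

lemma linked_4:
  assumes "\<And>c c'. {(x, c), (nb d x, c')} \<notin> F" "d \<in> D" "d \<noteq> j"
  shows "linked (dim_edges D - F) (level j (fst x j)) 4 (x, c) (nb d x, c')"
  unfolding linked_def
proof (intro exI conjI)
  let ?p = "[(x, c), (nb d x, \<not> c'), (x, \<not> c), (nb d x, c')]"
  have "{(nb d x, \<not> c'), (x, \<not> c)} = {(x, \<not> c), (nb d x, \<not> c')}" by auto
  then show "path (dim_edges D - F) ?p" using assms by (simp add: path_def)
  show "set ?p \<subseteq> level j (fst x j)" using assms(3) by (simp add: level_def)
qed simp_all

text \<open>
  Every edge of the ring in \<open>d\<close> has an end whose coordinate \<open>d\<close> differs from that of \<open>z\<close>,
  whereas the ring in \<open>d'\<close> never moves in the coordinate \<open>d\<close>.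
\<close>

lemma walk_edges_ring_disjoint:
  assumes "d \<noteq> d'" "d \<noteq> j" "d' \<noteq> j"
  shows "walk_edges (ring d j z) 7 \<inter> walk_edges (ring d' j z) 7 = {}"
proof -
  have moved: "\<exists>v \<in> f. fst (fst v) d \<noteq> fst z d" if f: "f \<in> walk_edges (ring d j z) 7" for f
  proof -
    obtain k c c' where k: "k < 7" "f = walk_edge (ring d j z) k c c'"
      using f unfolding walk_edges_def by blast
    have ne: "fst (ring d j z i) d \<noteq> fst z d" if "1 \<le> i" "i \<le> 6" for i
    proof -
      have "Suc i div 2 < 4" "Suc i div 2 \<noteq> 0" using that by auto
      then have "(of_nat (Suc i div 2) :: 4) \<noteq> of_nat 0"
        using of_nat_4_inject[of "Suc i div 2" 0] by auto
      then show ?thesis using assms(2) by (simp add: fst_ring)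
    qed
    show ?thesis
    proof (cases "k = 0")
      case True
      then show ?thesis using ne[of 1] k unfolding walk_edge_def by auto
    next
      case False
      then show ?thesis using ne[of k] k unfolding walk_edge_def by auto
    qed
  qed
  have "fst (fst v) d = fst z d" if "f \<in> walk_edges (ring d' j z) 7" "v \<in> f" for f v
    using that assms unfolding walk_edges_def walk_edge_def by (auto simp: fst_ring)
  then show ?thesis using moved by blast
qed

text \<open>
  A cycle of six cells uses each of three dimensions twice, in opposite directions; its five
  steps \<open>d, s, j, d, s\<close> lead from \<open>z\<close> to its \<open>j\<close>-neighbour.
\<close>

definition hexagon :: "nat \<Rightarrow> nat \<Rightarrow> nat \<Rightarrow> cell \<Rightarrow> nat \<Rightarrow> cell" where
  "hexagon d s j = walk (\<lambda>k. if k = 2 then j else if k = 0 \<or> k = 3 then d else s)"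

lemma hexagon_simps:
  "hexagon d s j z 0 = z"
  "hexagon d s j z (Suc 0) = nb d z"
  "hexagon d s j z 2 = nb s (nb d z)"
  "hexagon d s j z 3 = nb j (nb s (nb d z))"
  "hexagon d s j z 4 = nb d (nb j (nb s (nb d z)))"
  "hexagon d s j z 5 = nb s (nb d (nb j (nb s (nb d z))))"
  by (simp_all add: hexagon_def eval_nat_numeral)

lemma less_6: "k \<le> 5 \<Longrightarrow> k = 0 \<or> k = Suc 0 \<or> k = 2 \<or> k = 3 \<or> k = 4 \<or> k = (5::nat)"
  by auto

lemma fst_hexagon:
  assumes "d \<noteq> s" "d \<noteq> j" "s \<noteq> j" "k \<le> 5"
  shows "fst (hexagon d s j z k) i = fst z i
    + (if snd z then - 1 else 1) * (if i = d \<and> 1 \<le> k \<and> k \<le> 3 then 1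
       else if i = s \<and> 2 \<le> k \<and> k \<le> 4 then - 1 else if i = j \<and> 3 \<le> k then 1 else 0)"
  using less_6[OF assms(4)] assms(1-3) assms(1-3)[symmetric]
  by (elim disjE) (simp_all add: hexagon_simps del: One_nat_def)

lemma hexagon_5:
  assumes "d \<noteq> s" "d \<noteq> j" "s \<noteq> j"
  shows "hexagon d s j z 5 = nb j z"
  by (rule cell_eqI) (use assms in \<open>auto simp: fst_hexagon\<close>, auto simp: hexagon_def snd_walk)

lemma inj_on_hexagon:
  assumes "d \<noteq> s" "d \<noteq> j" "s \<noteq> j"
  shows "inj_on (hexagon d s j z) {..5}"
proof (rule inj_onI)
  fix k l assume kl: "k \<in> {..5}" "l \<in> {..5}" and eq: "hexagon d s j z k = hexagon d s j z l"
  have "(1 \<le> k \<and> k \<le> 3) = (1 \<le> l \<and> l \<le> 3)"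
    using arg_cong[OF eq, of "\<lambda>y. fst y d"] kl assms by (auto simp: fst_hexagon split: if_splits)
  moreover have "(2 \<le> k \<and> k \<le> 4) = (2 \<le> l \<and> l \<le> 4)"
    using arg_cong[OF eq, of "\<lambda>y. fst y s"] kl assms by (auto simp: fst_hexagon split: if_splits)
  moreover have "(3 \<le> k) = (3 \<le> l)"
    using arg_cong[OF eq, of "\<lambda>y. fst y j"] kl assms by (auto simp: fst_hexagon split: if_splits)
  ultimately show "k = l" using kl by simp presburger
qed

text \<open>
  All edges but the last contain a cell that has moved in the coordinate \<open>d\<close> in the direction of
  the first step. In the other hexagon the coordinate \<open>d\<close> can only move in the opposite
  direction, namely if \<open>s' = d\<close>. The last edges differ because \<open>s \<noteq> s'\<close>.
\<close>

lemma walk_edges_hexagon_disjoint: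
  assumes "d \<noteq> d'" "d \<noteq> s" "d \<noteq> j" "s \<noteq> j" "d' \<noteq> s'" "d' \<noteq> j" "s' \<noteq> j" "s \<noteq> s'"
  shows "walk_edges (hexagon d s j z) 5 \<inter> walk_edges (hexagon d' s' j z) 5 = {}"
proof -
  define a where "a = (\<lambda>d. fst z d + (if snd z then -1 else 1))"
  have early: "\<exists>v \<in> walk_edge (hexagon d s j z) k c c'. fst (fst v) d = a d"
    if "k < 4" "d \<noteq> s" "d \<noteq> j" "s \<noteq> j" for k c c' d s
  proof (cases "k = 0")
    case True
    then show ?thesis using that by (auto simp: walk_edge_def a_def fst_hexagon)
  next
    case False
    then show ?thesis using that by (auto simp: walk_edge_def a_def fst_hexagon)
  qed
  have other: "fst (fst v) d \<noteq> a d"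
    if "v \<in> walk_edge (hexagon d' s' j z) k c c'" "k < 5" "d \<noteq> d'" "d \<noteq> j" "d' \<noteq> s'" "d' \<noteq> j" "s' \<noteq> j"
    for d d' s' k c c' v
    using that by (auto simp: walk_edge_def a_def fst_hexagon split: if_splits)
  show ?thesis
  proof (rule ccontr)
    assume "\<not> ?thesis"
    then obtain k c c' l e e' where kl: "k < 5" "l < 5"
      and eq: "walk_edge (hexagon d s j z) k c c' = walk_edge (hexagon d' s' j z) l e e'"
      unfolding walk_edges_def by blast
    have "\<not> k < 4" using early[of k d s c c'] other[of _ d' s' l e e' d] kl(2) assms eq by metis
    moreover have "\<not> l < 4" using early[of l d' s' e e'] other[of _ d s k c c' d'] kl(1) assms eq by metis
    ultimately have "k = 4" "l = 4" using kl by auto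
    moreover have "hexagon d s j z 4 = nb s (nb j z)" if "d \<noteq> s" "d \<noteq> j" "s \<noteq> j" for d s
      using hexagon_5[OF that, of z] unfolding hexagon_simps by (metis nb_nb)
    ultimately have "{(nb s (nb j z), c), (nb j z, c')} = {(nb s' (nb j z), e), (nb j z, e')}"
      using eq assms hexagon_5 by (simp add: walk_edge_def)
    then have "nb s (nb j z) = nb s' (nb j z)" by (auto simp: doubleton_eq_iff)
    then show False using assms(8) by simp
  qed
qed

text \<open>
  Supplies the second dimension of each hexagon: distinct hexagons need distinct ones.
\<close>

lemma cyclic_shift_exists:
  assumes "finite I" "2 \<le> card I"
  shows "\<exists>\<sigma>. inj_on \<sigma> I \<and> (\<forall>d \<in> I. \<sigma> d \<in> I \<and> \<sigma> d \<noteq> d)"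
proof -
  let ?n = "card I"
  obtain h where h: "bij_betw h {0..<?n} I" using ex_bij_betw_nat_finite[OF assms(1)] by blast
  define t where "t = (\<lambda>k. if Suc k = ?n then 0 else Suc k)"
  let ?i = "inv_into {0..<?n} h"
  have t: "bij_betw ?i I {0..<?n}" using bij_betw_inv_into[OF h] .
  have t1: "inj_on t {0..<?n}" by (auto simp: inj_on_def t_def split: if_splits)
  have t2: "t k \<in> {0..<?n} \<and> t k \<noteq> k" if "k \<in> {0..<?n}" for k
    using that assms(2) by (auto simp: t_def)
  have i: "?i d \<in> {0..<?n}" "h (?i d) = d" if "d \<in> I" for d
    using that t h by (auto simp: bij_betw_def f_inv_into_f intro: inv_into_into)
  have "inj_on (h \<circ> t \<circ> ?i) I"
    using t t1 t2 h by (intro comp_inj_on) (auto simp: bij_betw_def intro: inj_on_subset)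
  moreover have "(h \<circ> t \<circ> ?i) d \<in> I \<and> (h \<circ> t \<circ> ?i) d \<noteq> d" if "d \<in> I" for d
  proof -
    have m: "t (?i d) \<in> {0..<?n}" "t (?i d) \<noteq> ?i d" using t2 i[OF that] by blast+
    then have "h (t (?i d)) \<noteq> h (?i d)"
      using bij_betw_imp_inj_on[OF h] i(1)[OF that] by (metis inj_onD)
    then show ?thesis using m(1) h i(2)[OF that] by (auto simp: bij_betw_def)
  qed
  ultimately show ?thesis by blast
qed

text \<open>
  The case of an edge whose dimension \<open>j\<close> splits the graph. Both the rings and the hexagons
  through it are disjoint families indexed by \<open>D\<close>, and \<open>sparse_member\<close> selects one along which
  twins can be chosen. In a ring all four \<open>d\<close>-steps are then available for expansion.
\<close>

lemma linked_across:
  assumes fin: "finite F" "finite D" and j: "j \<notin> D" and D2: "2 \<le> card D" and IH: "spans D F"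
    and X: "card (F \<inter> dim_edges (insert j D)) \<le> 2 * card D"
    and Y: "card (F \<inter> dim_edges D) < 2 * card D"
    and l: "even l" "6 \<le> l" "l \<le> 4 ^ card (insert j D)"
  shows "linked (dim_edges (insert j D) - F) UNIV l (y, b) (nb j y, b')"
proof -
  let ?E = "dim_edges (insert j D)"
  let ?X = "F \<inter> ?E" and ?Y = "F \<inter> dim_edges D"
  have YX: "?Y \<subseteq> ?X" using dim_edges_mono[of D "insert j D"] by blast
  have jD: "d \<noteq> j" if "d \<in> D" for d using that j by blast
  define M :: nat where "M = 4 ^ card D"
  have "(4::nat) ^ 2 \<le> 4 ^ card D" using D2 by (intro power_increasing) auto
  then have M: "16 \<le> M" "even M" "l \<le> 4 * M"
    using l(3) D2 j fin by (auto simp: M_def)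
  have Xeq: "F \<inter> walk_edges (walk w z) m = ?X \<inter> walk_edges (walk w z) m"
    if "\<forall>k<m. w k \<in> insert j D" for w z m
    using that unfolding walk_edges_def by auto
  show ?thesis
  proof (cases "l = 6")
    case True
    obtain \<sigma> where s: "inj_on \<sigma> D" "\<And>d. d \<in> D \<Longrightarrow> \<sigma> d \<in> D \<and> \<sigma> d \<noteq> d"
      using cyclic_shift_exists[OF fin(2) D2] by blast
    have "disjoint_family_on (\<lambda>d. walk_edges (hexagon d (\<sigma> d) j y) 5) D"
      unfolding disjoint_family_on_def
    proof (intro ballI impI)
      fix d d' assume d: "d \<in> D" "d' \<in> D" "d \<noteq> d'"
      then have "\<sigma> d \<noteq> \<sigma> d'" using s(1) by (auto simp: inj_on_def)
      then show "walk_edges (hexagon d (\<sigma> d) j y) 5 \<inter> walk_edges (hexagon d' (\<sigma> d') j y) 5 = {}"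
        using d s(2) jD by (intro walk_edges_hexagon_disjoint) metis+
    qed
    then obtain d where d: "d \<in> D" "card (?X \<inter> walk_edges (hexagon d (\<sigma> d) j y) 5) \<le> 2"
      "card (?Y \<inter> walk_edges (hexagon d (\<sigma> d) j y) 5) \<le> 1"
      using sparse_member[OF fin(2) _ _ YX X Y] fin(1) by blast
    let ?r = "hexagon d (\<sigma> d) j y"
    have ne: "d \<noteq> \<sigma> d" "d \<noteq> j" "\<sigma> d \<noteq> j" "\<sigma> d \<in> D" using s(2)[OF d(1)] jD d(1) by auto
    let ?w = "\<lambda>k::nat. if k = 2 then j else if k = 0 \<or> k = 3 then d else \<sigma> d"
    have w: "?r = walk ?w y" by (simp add: hexagon_def)
    have "\<exists>g. g 0 = b \<and> g 5 = b' \<and> (\<forall>k<5. walk_edge (walk ?w y) k (g k) (g (Suc k)) \<notin> F)"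
    proof (rule sparse_walk_lift[where D = D])
      show "inj_on (walk ?w y) {..5}" using inj_on_hexagon[OF ne(1-3), of y] unfolding w .
      show "card (F \<inter> walk_edges (walk ?w y) 5) \<le> 2"
        using d ne Xeq[of 5 ?w y] unfolding w by simp
      show "card (F \<inter> walk_edges (walk ?w y) 5 \<inter> dim_edges D) \<le> 1"
        using d(3) unfolding w by (simp add: Int_ac)
    qed (use fin d ne in auto)
    then obtain g where g: "g 0 = b" "g 5 = b'" "\<forall>k<5. walk_edge ?r k (g k) (g (Suc k)) \<notin> F"
      unfolding w by blast
    let ?p = "map (\<lambda>k. (?r k, g k)) [0..<6]"
    have "path (?E - F) ?p"
      unfolding path_def successively_conv_nth
    proof (intro conjI allI impI)
      have "inj_on (\<lambda>k. (?r k, g k)) {..5}"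
        using inj_on_hexagon[OF ne(1-3), of y] by (auto simp: inj_on_def)
      moreover have "set [0..<6] = {..5::nat}" by auto
      ultimately show "distinct ?p" by (simp add: distinct_map)
      fix k assume k: "Suc k < length ?p"
      then have "walk_edge ?r k (g k) (g (Suc k)) \<in> ?E - F"
        using g(3) d(1) ne unfolding w by auto
      then show "{?p ! k, ?p ! Suc k} \<in> ?E - F"
        using k by (simp add: walk_edge_def del: upt_Suc)
    qed
    moreover have "hd ?p = (y, b)" "last ?p = (nb j y, b')"
      using g hexagon_5[OF ne(1-3), of y] by (simp_all add: hd_map last_map hexagon_simps(1))
    ultimately show ?thesis unfolding linked_def True by (intro exI[of _ ?p]) simp
  next
    case False
    then have l8: "8 \<le> l" using l by presburger
    have "disjoint_family_on (\<lambda>d. walk_edges (ring d j y) 7) D"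
      unfolding disjoint_family_on_def using walk_edges_ring_disjoint jD by metis
    then obtain d where d: "d \<in> D" "card (?X \<inter> walk_edges (ring d j y) 7) \<le> 2"
      "card (?Y \<inter> walk_edges (ring d j y) 7) \<le> 1"
      using sparse_member[OF fin(2) _ _ YX X Y] fin(1) by blast
    let ?r = "ring d j y"
    have ne: "d \<noteq> j" using jD d(1) .
    let ?w = "\<lambda>k::nat. if even k then d else j"
    have w: "?r = walk ?w y" by (simp add: ring_def)
    have "\<exists>g. g 0 = b \<and> g 7 = b' \<and> (\<forall>k<7. walk_edge (walk ?w y) k (g k) (g (Suc k)) \<notin> F)"
    proof (rule sparse_walk_lift[where D = D])
      show "inj_on (walk ?w y) {..7}" using inj_on_ring[OF ne, of y] unfolding w .
      show "card (F \<inter> walk_edges (walk ?w y) 7) \<le> 2"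
        using d Xeq[of 7 ?w y] unfolding w by simp
      show "card (F \<inter> walk_edges (walk ?w y) 7 \<inter> dim_edges D) \<le> 1"
        using d(3) unfolding w by (simp add: Int_ac)
    qed (use fin d in auto)
    then obtain g where g: "g 0 = b" "g 7 = b'" "\<And>k. k<7 \<Longrightarrow> walk_edge ?r k (g k) (g (Suc k)) \<notin> F"
      unfolding w by blast
    define seg where "seg = (\<lambda>i k. linked (?E - F) (level j (fst (?r (2 * i)) j)) k
        (?r (2 * i), g (2 * i)) (?r (2 * i + 1), g (2 * i + 1)))"
    have assemble: "linked (?E - F) UNIV (\<Sum>i<4. k i) (y, b) (nb j y, b')"
      if "\<And>i. i < 4 \<Longrightarrow> seg i (k i)" for k
    proof -
      have "linked (?E - F) (\<Union>i<4. level j (fst (?r (2 * i)) j)) (\<Sum>i<4. k i)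
        (y, g 0) (?r (2 * 4 - 1), g (2 * 4 - 1))"
        using that g(3) unfolding seg_def by (intro linked_ring_segments[OF ne]) auto
      then show ?thesis using g(1,2) ring_7[OF ne, of y] by (auto elim: linked_mono)
    qed
    have seg: "seg i k" if "i < 4" "k = 2 \<or> even k \<and> 6 \<le> k \<and> k \<le> M" for i k
    proof -
      have "{(?r (2 * i), g (2 * i)), (nb d (?r (2 * i)), g (2 * i + 1))} \<notin> F"
        using g(3)[of "2 * i"] that(1) by (simp add: walk_edge_def ring_Suc)
      then have "linked (dim_edges D - F) (level j (fst (?r (2 * i)) j)) k
        (?r (2 * i), g (2 * i)) (nb d (?r (2 * i)), g (2 * i + 1))"
        using segment[OF IH d(1) j] that(2) unfolding M_def by blast
      then show ?thesis unfolding seg_def ring_pair(1)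
        using dim_edges_mono[of D "insert j D"] by (elim linked_mono) auto
    qed
    consider "l = 8" | "l = 10" | "12 \<le> l" using l8 l(1) by fastforce
    then show ?thesis
    proof cases
      case 1
      then show ?thesis using assemble[of "\<lambda>_. 2"] seg by simp
    next
      case 2
      \<comment> \<open>10 is not a sum of four numbers from 2, 6, 8, \<open>\<dots>\<close>, so one segment must have four vertices. At most one fault of
        the ring has dimension \<open>d\<close>, hence one of the first two \<open>d\<close>-steps is free of faults.\<close>
      have "\<exists>i<2. \<forall>c c'. walk_edge ?r (2 * i) c c' \<notin> F"
      proof (rule ccontr)
        assume no: "\<not> ?thesis"
        obtain c c' where 0: "walk_edge ?r 0 c c' \<in> F" using no by (auto dest!: spec[of _ 0])
        obtain e e' where 1: "walk_edge ?r 2 e e' \<in> F" using no by (auto dest!: spec[of _ 1])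
        have "walk_edge ?r 0 c c' \<noteq> walk_edge ?r 2 e e'"
          using walk_edge_inject[OF inj_on_ring[OF ne, of y], of 0 2] by auto
        then have "card {walk_edge ?r 0 c c', walk_edge ?r 2 e e'} = 2" by simp
        moreover have "{walk_edge ?r 0 c c', walk_edge ?r 2 e e'} \<subseteq> ?Y \<inter> walk_edges ?r 7"
          using 0 1 d(1) unfolding w walk_edges_def by fastforce
        ultimately have "2 \<le> card (?Y \<inter> walk_edges ?r 7)"
          using fin(1) card_mono[of "?Y \<inter> walk_edges ?r 7"] by (metis finite_Int)
        then show False using d(3) by simp
      qed
      then obtain i where i: "i < 2" "\<And>c c'. walk_edge ?r (2 * i) c c' \<notin> F" by blast
      have "seg i 4"
        using linked_4[of "?r (2 * i)" d F "insert j D" j] i(2) d(1) ne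
        unfolding seg_def ring_pair(1) walk_edge_def by (simp add: ring_Suc)
      then have "linked (?E - F) UNIV (\<Sum>m<4. if m = i then 4 else 2) (y, b) (nb j y, b')"
        using seg by (intro assemble) auto
      moreover have "(\<Sum>m<4. if m = i then 4 else 2) = (10::nat)"
        using i(1) by (auto simp: eval_nat_numeral less_Suc_eq)
      ultimately show ?thesis using 2 by simp
    next
      case 3
      obtain k0 k1 k2 k3 where k: "l = k0 + k1 + k2 + k3" "even k0" "6 \<le> k0" "k0 \<le> M"
        "\<forall>k \<in> {k1, k2, k3}. k = 2 \<or> even k \<and> 6 \<le> k \<and> k \<le> M"
        using split_length[OF M(2,1) l(1) 3 M(3)] by metis
      define ks where "ks = (!) [k0, k1, k2, k3]"
      have ks: "ks 0 = k0" "ks 1 = k1" "ks 2 = k2" "ks 3 = k3" by (simp_all add: ks_def)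
      have "seg 0 k0" "seg 1 k1" "seg 2 k2" "seg 3 k3" using seg k by simp_all
      moreover have "i = 0 \<or> i = 1 \<or> i = 2 \<or> i = 3" if "i < 4" for i :: nat using that by auto
      ultimately have "seg i (ks i)" if "i < 4" for i using that ks by metis
      then have "linked (?E - F) UNIV (\<Sum>i<4. ks i) (y, b) (nb j y, b')" by (rule assemble)
      moreover have "(\<Sum>i<4. ks i) = l" unfolding ks_def k(1) by (simp add: eval_nat_numeral)
      ultimately show ?thesis by simp
    qed
  qed
qed

section \<open>Edges of the other dimensions\<close>

text \<open>
  The part of the ring that leads through the three levels of \<open>j\<close> other than that of \<open>x\<close>.
\<close>

definition ring_middle :: "nat \<Rightarrow> nat \<Rightarrow> cell \<Rightarrow> vertex set set" where
  "ring_middle j d x = {walk_edge (ring j d x) k c c' | k c c'. 1 \<le> k \<and> k \<le> 5}"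

text \<open>
  A ring meets the level of its start \<open>x\<close> only in \<open>x\<close> and \<open>nb d x\<close>, and two rings in the same
  dimensions with a common cell consist of the same cells. If \<open>x\<close> and \<open>x'\<close> have the same side,
  both rings move in the same direction and \<open>k = k'\<close>; otherwise one is the other run backwards
  and \<open>k + k' = 7\<close>.
\<close>

lemma ring_meet:
  assumes "j \<noteq> d" and lev: "fst x j = fst x' j"
    and k: "1 \<le> k" "k \<le> 6" "1 \<le> k'" "k' \<le> 6" and eq: "ring j d x k = ring j d x' k'"
  shows "x' = x \<or> x' = nb d x"
proof -
  have dj: "d \<noteq> j" using assms(1) by simp
  have at: "fst (ring j d x k) i = fst (ring j d x' k') i" for i using eq by simp
  have side: "(snd x \<noteq> odd k) = (snd x' \<noteq> odd k')" using eq snd_ring by metis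
  have half: "Suc k div 2 \<in> {1, 2, 3}" "Suc k' div 2 \<in> {1, 2, 3}" using k by auto
  have j: "(if snd x then - of_nat (Suc k div 2) else of_nat (Suc k div 2) :: 4)
      = (if snd x' then - of_nat (Suc k' div 2) else of_nat (Suc k' div 2))"
    using at[of j] lev by (simp add: fst_ring[OF assms(1)])
  show ?thesis
  proof (cases "snd x = snd x'")
    case True
    then have "(of_nat (Suc k div 2) :: 4) = of_nat (Suc k' div 2)" using j by (simp split: if_splits)
    then have "Suc k div 2 = Suc k' div 2" using half by (intro of_nat_4_inject) auto
    moreover have "odd k = odd k'" using side True by auto
    ultimately have kk: "k = k'" by presburger
    have "x' = x"
    proof (rule cell_eqI)
      show "fst x' i = fst x i" for i
        using at[of i] lev True kk dj by (simp add: fst_ring[OF assms(1)] split: if_splits)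
    qed (use True in simp)
    then show ?thesis ..
  next
    case False
    then have "(of_nat (Suc k div 2) :: 4) = - of_nat (Suc k' div 2)"
      using j by (metis minus_minus)
    then have "Suc k div 2 + Suc k' div 2 = 4" using half by auto
    moreover have "odd k \<noteq> odd k'" using side False by auto
    ultimately have kk: "k div 2 + k' div 2 = 3" by presburger
    then have "(of_nat (k div 2) :: 4) + of_nat (k' div 2) = of_nat 3" by (metis of_nat_add)
    then have B: "(of_nat (k' div 2) :: 4) = 3 - of_nat (k div 2)" by (simp add: algebra_simps)
    have flip: "3 + u = v \<Longrightarrow> 1 + v = u" for u v :: 4 by auto
    have "x' = nb d x"
    proof (rule cell_eqI)
      show "fst x' i = fst (nb d x) i" for i
        using at[of i] lev False dj
        by (auto simp: fst_ring[OF assms(1)] B algebra_simps split: if_splits dest: flip)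
    qed (use False in simp)
    then show ?thesis ..
  qed
qed

lemma ring_middle_meet:
  assumes "j \<noteq> d" "fst x j = fst x' j" "f \<in> ring_middle j d x" "f \<in> ring_middle j d x'"
  shows "x' = x \<or> x' = nb d x"
proof -
  obtain k c c' k' e e' where k: "1 \<le> k" "k \<le> 5" "f = walk_edge (ring j d x) k c c'"
    "1 \<le> k'" "k' \<le> 5" "f = walk_edge (ring j d x') k' e e'"
    using assms(3,4) unfolding ring_middle_def by blast
  then have "ring j d x k = ring j d x' k' \<or> ring j d x k = ring j d x' (Suc k')"
    unfolding walk_edge_def by (auto simp: doubleton_eq_iff)
  then show ?thesis using ring_meet[OF assms(1,2), of k] k by fastforce
qed

lemma ring_middle_level:
  assumes "j \<noteq> d" "f \<in> ring_middle j d x"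
  shows "f \<inter> level j (fst x j) = {}"
proof -
  obtain k c c' where k: "1 \<le> k" "k \<le> 5" "f = walk_edge (ring j d x) k c c'"
    using assms(2) unfolding ring_middle_def by blast
  have "fst (ring j d x m) j \<noteq> fst x j" if "1 \<le> m" "m \<le> 6" for m
  proof -
    have "Suc m div 2 < 4" "Suc m div 2 \<noteq> 0" using that by auto
    then have "(of_nat (Suc m div 2) :: 4) \<noteq> of_nat 0"
      using of_nat_4_inject[of "Suc m div 2" 0] by auto
    then show ?thesis by (simp add: fst_ring[OF assms(1)])
  qed
  then show ?thesis using k by (auto simp: walk_edge_def level_def)
qed

lemma card_class_le_4:
  "card {{(x, c), (nb d x, c')} | (c :: bool) (c' :: bool). True} \<le> 4"
proof -
  have eq: "{{(x, c), (nb d x, c')} | (c :: bool) (c' :: bool). True} = (\<lambda>(c, c'). {(x, c), (nb d x, c')}) ` UNIV"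
    by auto
  show ?thesis
    unfolding eq
    using card_image_le[of "UNIV :: (bool \<times> bool) set" "\<lambda>(c, c'). {(x, c), (nb d x, c')}"] by simp
qed

lemma six_four_power:
  fixes m :: nat
  assumes "2 \<le> m"
  shows "16 * (m * m) + 30 < 6 * 4 ^ m"
  using assms
proof (induction m rule: nat_induct_at_least)
  case (Suc m)
  have "m \<le> q \<Longrightarrow> 16 * q + 32 * m + 46 \<le> 4 * (16 * q + 30)" for q by simp
  then have "16 * (m * m) + 32 * m + 46 \<le> 4 * (16 * (m * m) + 30)" by (simp only: le_square)
  moreover have "16 * (Suc m * Suc m) + 30 = 16 * (m * m) + 32 * m + 46" by (simp add: algebra_simps)
  ultimately have "16 * (Suc m * Suc m) + 30 \<le> 4 * (16 * (m * m) + 30)" by (simp only:)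
  also have "\<dots> < 4 * (6 * 4 ^ m)" using Suc.IH by (rule mult_strict_left_mono) simp
  finally show ?case by simp
qed simp

text \<open>
  Suppose the detour of every step \<open>t\<close> of the path is blocked. By \<open>walk_lift\<close>, blocking takes
  two faults of dimension \<open>j\<close> at one of the ends of the step, or at least three faults in its
  detour. With weight 3 for faults at the ends (\<open>touch\<close>) and weight 2 for faults in the middle
  (\<open>across\<close>), every step receives weight at least 6. Conversely, let \<open>m = card D\<close>. A fault that
  meets the level of the path has weight only if its dimension is \<open>j\<close>; it then has a single
  vertex in that level, which lies on at most two steps, so it contributes at most 6. Any other
  fault lies, for each dimension \<open>d\<close>, in the middle of at most one ring, and so in the detours
  of at most four steps of dimension \<open>d\<close>; it contributes at most \<open>8 m\<close>. The total is at most \<open>8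
  m \<cdot> 2 m\<close>, but the path has at least \<open>4 ^ m - 5\<close> steps, and \<open>6 (4 ^ m - 5) > 16 m\<^sup>2\<close>. The margin
  is narrow for \<open>m = 2\<close>, which is why the two kinds of faults are weighted differently.
\<close>

lemma crossable_edge:
  assumes fin: "finite F" "finite D" and j: "j \<notin> D" and D2: "2 \<le> card D"
    and X: "card (F \<inter> dim_edges (insert j D)) \<le> 2 * card D"
    and p: "path (dim_edges D - F) p" "set p \<subseteq> level j a" and len: "4 ^ card D \<le> length p + 4"
  shows "\<exists>t d x c c' g. Suc t < length p \<and> d \<in> D \<and> p ! t = (x, c) \<and> p ! Suc t = (nb d x, c')
     \<and> g 0 = c \<and> g 7 = c' \<and> (\<forall>k<7. walk_edge (ring j d x) k (g k) (g (Suc k)) \<notin> F)"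
proof (rule ccontr)
  assume no: "\<not> ?thesis"
  define N where "N = length p - 1"
  let ?X = "F \<inter> dim_edges (insert j D)" and ?m = "card D"
  have finX: "finite ?X" using fin by simp
  have dist: "distinct p" using p(1) by (simp add: path_def)
  have "\<exists>d x c c'. d \<in> D \<and> p ! t = (x, c) \<and> p ! Suc t = (nb d x, c')" if "t < N" for t
  proof -
    have "{p ! t, p ! Suc t} \<in> dim_edges D - F"
      using p(1) that by (auto simp: path_def successively_conv_nth N_def)
    then have "{p ! t, p ! Suc t} \<in> dim_edges D" by blast
    then show ?thesis by (elim dim_edgeE) blast
  qed
  then obtain dd xx cc cc' where pt: "\<And>t. t < N \<Longrightarrow> dd t \<in> D"
      "\<And>t. t < N \<Longrightarrow> p ! t = (xx t, cc t)" "\<And>t. t < N \<Longrightarrow> p ! Suc t = (nb (dd t) (xx t), cc' t)"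
    by metis
  have jd: "j \<noteq> dd t" if "t < N" for t using pt(1)[OF that] j by auto
  have lev: "fst (xx t) j = a" if "t < N" for t
  proof -
    have "p ! t \<in> set p" using that by (simp add: N_def)
    then show ?thesis using p(2) pt(2)[OF that] by (auto simp: level_def)
  qed
  define FI where "FI = {f \<in> ?X. f \<inter> level j a \<noteq> {}}"
  define FM where "FM = {f \<in> ?X. f \<inter> level j a = {}}"
  have finIM: "finite FI" "finite FM" using fin(1) by (simp_all add: FI_def FM_def)
  have "card FI + card FM = card (FI \<union> FM)"
    using finIM by (intro card_Un_disjoint[symmetric]) (auto simp: FI_def FM_def)
  also have "FI \<union> FM = ?X" by (auto simp: FI_def FM_def)
  finally have IM: "card FI + card FM \<le> 2 * ?m" using X by simp
  define touch where "touch = (\<lambda>t f. f \<in> dim_edges {j} \<and> (p ! t \<in> f \<or> p ! Suc t \<in> f))"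
  define across where "across = (\<lambda>t f. f \<in> ring_middle j (dd t) (xx t))"
  have weight: "6 \<le> 3 * card {f \<in> FI. touch t f} + 2 * card {f \<in> FM. across t f}" if t: "t < N" for t
  proof (rule ccontr)
    assume small: "\<not> ?thesis"
    let ?A = "{f \<in> FI. touch t f}" and ?B = "{f \<in> FM. across t f}"
    let ?r = "ring j (dd t) (xx t)"
    have finAB: "finite ?A" "finite ?B" using finIM by simp_all
    have small': "card ?A \<le> 1" "card ?A + card ?B \<le> 2" using small by linarith+
    have r7: "?r 7 = nb (dd t) (xx t)" using ring_7[OF jd[OF t]] .
    have dims: "walk_edge ?r k e e' \<in> dim_edges {if even k then j else dd t}" for k e e'
      by (simp add: ring_def)
    have inX: "walk_edge ?r k e e' \<in> F \<Longrightarrow> walk_edge ?r k e e' \<in> ?X" for k e e'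
      using pt(1)[OF t] by (simp add: ring_def)
    have lt: "p ! t \<in> level j a" "p ! Suc t \<in> level j a"
      using p(2) t nth_mem[of t p] nth_mem[of "Suc t" p] by (auto simp: N_def)
    have start: "walk_edge ?r 0 (cc t) e \<in> ?A" if "walk_edge ?r 0 (cc t) e \<in> F" for e
    proof -
      have "p ! t \<in> walk_edge ?r 0 (cc t) e" using pt(2)[OF t] by (simp add: walk_edge_def)
      then show ?thesis using inX[OF that] dims[of 0] lt unfolding FI_def touch_def by auto
    qed
    have stop: "walk_edge ?r 6 e (cc' t) \<in> ?A" if "walk_edge ?r 6 e (cc' t) \<in> F" for e
    proof -
      have "p ! Suc t \<in> walk_edge ?r 6 e (cc' t)" using pt(3)[OF t] r7 by (simp add: walk_edge_def)
      then show ?thesis using inX[OF that] dims[of 6] lt unfolding FI_def touch_def by auto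
    qed
    have inj: "inj_on ?r {..7}" using inj_on_ring[OF jd[OF t]] .
    have "\<exists>g. g 0 = cc t \<and> g 7 = cc' t \<and> (\<forall>k<7. walk_edge ?r k (g k) (g (Suc k)) \<notin> F)"
    proof (rule walk_lift[OF inj _ fin(1)])
      have "{f \<in> F. \<exists>k e e'. k < 7 \<and> (k = 0 \<longrightarrow> e = cc t) \<and> (Suc k = 7 \<longrightarrow> e' = cc' t)
          \<and> f = walk_edge ?r k e e'} \<subseteq> ?A \<union> ?B"
      proof (intro subsetI UnCI)
        fix h assume h: "h \<in> {f \<in> F. \<exists>k e e'. k < 7 \<and> (k = 0 \<longrightarrow> e = cc t) \<and> (Suc k = 7 \<longrightarrow> e' = cc' t)
          \<and> f = walk_edge ?r k e e'}" and "h \<notin> ?B"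
        then obtain k e e' where k: "k < 7" "k = 0 \<longrightarrow> e = cc t" "Suc k = 7 \<longrightarrow> e' = cc' t"
          and hk: "h = walk_edge ?r k e e'" by blast
        then have f: "walk_edge ?r k e e' \<in> F" and nB: "walk_edge ?r k e e' \<notin> ?B"
          using h \<open>h \<notin> ?B\<close> by simp_all
        have "k = 0 \<or> k = 6"
        proof (rule ccontr)
          assume "\<not> ?thesis"
          then have "walk_edge ?r k e e' \<in> ring_middle j (dd t) (xx t)"
            using k(1) unfolding ring_middle_def by fastforce
          moreover from this have "walk_edge ?r k e e' \<inter> level j a = {}"
            using ring_middle_level[OF jd[OF t], of _ "xx t"] lev[OF t] by simp
          ultimately have "walk_edge ?r k e e' \<in> ?B"
            using inX[OF f] unfolding FM_def across_def by simp
          then show False using nB by blast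
        qed
        then show "h \<in> ?A"
          using start[of e'] stop[of e] k f unfolding hk by auto
      qed
      then have "card {f \<in> F. \<exists>k e e'. k < 7 \<and> (k = 0 \<longrightarrow> e = cc t) \<and> (Suc k = 7 \<longrightarrow> e' = cc' t)
          \<and> f = walk_edge ?r k e e'} \<le> card (?A \<union> ?B)"
        using finAB by (intro card_mono) auto
      also have "\<dots> \<le> card ?A + card ?B" by (rule card_Un_le)
      finally show "card {f \<in> F. \<exists>k e e'. k < 7 \<and> (k = 0 \<longrightarrow> e = cc t) \<and> (Suc k = 7 \<longrightarrow> e' = cc' t)
          \<and> f = walk_edge ?r k e e'} \<le> 2" using small'(2) by linarith
      show "\<exists>e. walk_edge ?r 0 (cc t) e \<notin> F"
        using card_twins_ge_2[OF finAB(1), of "walk_edge ?r 0 (cc t)"] start small'(1)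
          walk_edge_inject[OF inj, of 0 0 "cc t" True "cc t" False] by fastforce
      show "\<exists>e. walk_edge ?r (7 - 1) e (cc' t) \<notin> F"
        using card_twins_ge_2[OF finAB(1), of "\<lambda>e. walk_edge ?r 6 e (cc' t)"] stop small'(1)
          walk_edge_inject[OF inj, of 6 6 True "cc' t" False "cc' t"] by fastforce
    qed simp
    moreover have "Suc t < length p" using t by (simp add: N_def)
    ultimately show False using no pt[OF t] by blast
  qed
  have touch_le: "card {t \<in> {..<N}. touch t f} \<le> 2" if f: "f \<in> FI" for f
  proof (cases "f \<in> dim_edges {j}")
    case False
    then show ?thesis by (simp add: touch_def)
  next
    case True
    then obtain w e e' where w: "f = {(w, e), (nb j w, e')}" unfolding dim_edges_def by blast
    have "\<exists>v. f \<inter> level j a \<subseteq> {v}"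
    proof (cases "fst w j = a")
      case True
      then have "f \<inter> level j a \<subseteq> {(w, e)}" unfolding w by (auto simp: level_def)
      then show ?thesis by blast
    next
      case False
      then have "f \<inter> level j a \<subseteq> {(nb j w, e')}" unfolding w by (auto simp: level_def)
      then show ?thesis by blast
    qed
    then obtain v where v: "f \<inter> level j a \<subseteq> {v}" by blast
    have at: "p ! t = v" if "p ! t \<in> f" "t < length p" for t
      using v that p(2) nth_mem[of t p] by blast
    show ?thesis
    proof (cases "\<exists>t0 < length p. p ! t0 = v")
      case True
      then obtain t0 where t0: "t0 < length p" "p ! t0 = v" by blast
      have "{t \<in> {..<N}. touch t f} \<subseteq> {t0, t0 - 1}"
      proof
        fix t assume "t \<in> {t \<in> {..<N}. touch t f}"
        then have "Suc t < length p" "p ! t \<in> f \<or> p ! Suc t \<in> f"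
          unfolding touch_def N_def by auto
        then have "Suc t < length p" "p ! t = v \<or> p ! Suc t = v"
          using at[of t] at[of "Suc t"] by auto
        then have "t = t0 \<or> Suc t = t0" using t0 dist by (metis Suc_lessD nth_eq_iff_index_eq)
        then show "t \<in> {t0, t0 - 1}" by auto
      qed
      then have "card {t \<in> {..<N}. touch t f} \<le> card {t0, t0 - 1}" by (intro card_mono) auto
      also have "\<dots> \<le> 2" by (simp add: card_insert_if)
      finally show ?thesis .
    next
      case False
      then have "\<not> touch t f" if "t < N" for t
        using that at[of t] at[of "Suc t"] unfolding touch_def N_def by (auto simp: less_diff_conv)
      then have "{t \<in> {..<N}. touch t f} = {}" by auto
      then show ?thesis by (simp only: card.empty)
    qed
  qed
  have across_le: "card {t \<in> {..<N}. across t f} \<le> 4 * ?m" for f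
  proof -
    let ?T = "{t \<in> {..<N}. across t f}"
    define K where "K = (\<lambda>d. {{p ! t, p ! Suc t} | t. t \<in> ?T \<and> dd t = d})"
    have K: "finite (K d) \<and> card (K d) \<le> 4" for d
    proof (cases "\<exists>t \<in> ?T. dd t = d")
      case False
      then have "K d = {}" by (auto simp: K_def)
      then show ?thesis by simp
    next
      case True
      then obtain s where s: "s < N" "across s f" "dd s = d" by auto
      have "K d \<subseteq> {{(xx s, c), (nb d (xx s), c')} | (c :: bool) (c' :: bool). True}"
      proof
        fix e assume "e \<in> K d"
        then obtain t where t: "t < N" "across t f" "dd t = d" "e = {p ! t, p ! Suc t}"
          unfolding K_def by auto
        have "xx t = xx s \<or> xx t = nb d (xx s)"
          using ring_middle_meet[of j d "xx s" "xx t" f] s t jd[OF s(1)] lev unfolding across_def by auto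
        moreover have "e = {(xx t, cc t), (nb d (xx t), cc' t)}" using t pt(2,3)[OF t(1)] by simp
        ultimately have "e = {(xx s, cc t), (nb d (xx s), cc' t)} \<or> e = {(xx s, cc' t), (nb d (xx s), cc t)}"
          by auto
        then show "e \<in> {{(xx s, c), (nb d (xx s), c')} | (c :: bool) (c' :: bool). True}" by blast
      qed
      moreover have "finite {{(xx s, c), (nb d (xx s), c')} | (c :: bool) (c' :: bool). True}"
        by (rule finite_subset[of _ "(\<lambda>(c, c'). {(xx s, c), (nb d (xx s), c')}) ` UNIV"]) auto
      ultimately show ?thesis
        using card_class_le_4[of "xx s" d] by (meson card_mono finite_subset le_trans)
    qed
    have "inj_on (\<lambda>t. {p ! t, p ! Suc t}) ?T"
    proof (rule inj_onI)
      fix t s assume ts: "t \<in> ?T" "s \<in> ?T" "{p ! t, p ! Suc t} = {p ! s, p ! Suc s}"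
      then have "Suc t < length p" "Suc s < length p" by (auto simp: N_def)
      then show "t = s" using ts(3) dist by (auto simp: doubleton_eq_iff nth_eq_iff_index_eq)
    qed
    then have "card ?T = card ((\<lambda>t. {p ! t, p ! Suc t}) ` ?T)" by (simp add: card_image)
    also have "\<dots> \<le> card (\<Union>d\<in>D. K d)"
      using pt(1) K fin(2) unfolding K_def by (intro card_mono) auto
    also have "\<dots> \<le> (\<Sum>d\<in>D. card (K d))" using fin(2) by (rule card_UN_le)
    also have "\<dots> \<le> (\<Sum>d\<in>D. 4)" using K by (intro sum_mono) blast
    finally show ?thesis by simp
  qed
  have swap: "(\<Sum>t<N. card {f \<in> Y. R t f}) = (\<Sum>f\<in>Y. card {t \<in> {..<N}. R t f})" if "finite Y" for Y and R :: "nat \<Rightarrow> vertex set \<Rightarrow> bool"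
    using that by (intro sum_multicount_gen) auto
  have "6 * N \<le> (\<Sum>t<N. 3 * card {f \<in> FI. touch t f} + 2 * card {f \<in> FM. across t f})"
  proof -
    have "(\<Sum>t<N. 6) \<le> (\<Sum>t<N. 3 * card {f \<in> FI. touch t f} + 2 * card {f \<in> FM. across t f})"
      using weight by (intro sum_mono) simp
    then show ?thesis by simp
  qed
  also have "\<dots> = 3 * (\<Sum>f\<in>FI. card {t \<in> {..<N}. touch t f}) + 2 * (\<Sum>f\<in>FM. card {t \<in> {..<N}. across t f})"
    by (simp add: sum.distrib swap[OF finIM(1)] swap[OF finIM(2)] flip: sum_distrib_left)
  also have "\<dots> \<le> 3 * (\<Sum>f\<in>FI. 2) + 2 * (\<Sum>f\<in>FM. 4 * ?m)"
    using touch_le across_le by (intro add_mono mult_left_mono sum_mono) auto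
  also have "\<dots> = 6 * card FI + 8 * ?m * card FM" by simp
  also have "\<dots> \<le> 8 * ?m * card FI + 8 * ?m * card FM" using D2 by (intro add_mono mult_right_mono) auto
  also have "\<dots> = 8 * ?m * (card FI + card FM)" by (simp add: distrib_left)
  also have "\<dots> \<le> 8 * ?m * (2 * ?m)" using IM by (intro mult_left_mono) auto
  finally have "6 * N \<le> 16 * (?m * ?m)" by simp
  moreover have "6 * 4 ^ ?m \<le> 6 * N + 30" using len by (simp add: N_def)
  ultimately show False using six_four_power[OF D2] by linarith
qed

text \<open>
  The case of an edge that lies in one of the levels. Inserting the detour adds three segments,
  one in each of the other levels.
\<close>

lemma linked_along:
  assumes fin: "finite F" "finite D" and j: "j \<notin> D" and D2: "2 \<le> card D" and IH: "spans D F"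
    and X: "card (F \<inter> dim_edges (insert j D)) \<le> 2 * card D"
    and i: "i \<in> D" and l: "even l" "6 \<le> l" "l \<le> 4 ^ card (insert j D)"
  shows "linked (dim_edges (insert j D) - F) UNIV l (y, b) (nb i y, b')"
proof -
  let ?E = "dim_edges (insert j D)"
  have sub: "dim_edges D - F \<subseteq> ?E - F" using dim_edges_mono[of D "insert j D"] by blast
  define M :: nat where "M = 4 ^ card D"
  have "(4::nat) ^ 2 \<le> 4 ^ card D" using D2 by (intro power_increasing) auto
  then have M: "16 \<le> M" "even M" "l \<le> 4 * M"
    using l(3) D2 j fin by (auto simp: M_def)
  show ?thesis
  proof (cases "l \<le> M")
    case True
    then have "linked (dim_edges D - F) UNIV l (y, b) (nb i y, b')"
      using IH i l unfolding spans_def M_def by blast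
    then show ?thesis using sub by (rule linked_mono) simp
  next
    case False
    then have "12 \<le> l" using M by linarith
    then obtain k0 k1 k2 k3 where k: "l = k0 + k1 + k2 + k3" "even k0" "6 \<le> k0" "k0 \<le> M" "M \<le> k0 + 4"
        "\<forall>k \<in> {k1, k2, k3}. k = 2 \<or> even k \<and> 6 \<le> k \<and> k \<le> M"
      using split_length[OF M(2,1) l(1) _ M(3)] False by (metis not_le)
    have "linked (dim_edges D - F) UNIV k0 (y, b) (nb i y, b')"
      using IH i k unfolding spans_def M_def by blast
    then have "linked (dim_edges D - F) (level j (fst y j)) k0 (y, b) (nb i y, b')"
      using linked_level[of _ _ _ _ _ D j] j by fastforce
    then obtain p where p: "p \<noteq> []" "path (dim_edges D - F) p" "hd p = (y, b)" "last p = (nb i y, b')"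
      "length p = k0" "set p \<subseteq> level j (fst y j)"
      unfolding linked_def by blast
    obtain t d x c c' g where t: "Suc t < length p" "d \<in> D" "p ! t = (x, c)" "p ! Suc t = (nb d x, c')"
      "g 0 = c" "g 7 = c'" and g: "\<And>k. k < 7 \<Longrightarrow> walk_edge (ring j d x) k (g k) (g (Suc k)) \<notin> F"
      using crossable_edge[OF fin j D2 X p(2,6)] k(5) p(5) unfolding M_def by blast
    have ne: "d \<noteq> j" "j \<noteq> d" using t(2) j by auto
    have xj: "fst x j = fst y j"
      using p(6) t(1,3) nth_mem[of t p] by (auto simp: level_def)
    let ?z = "nb j x" and ?r = "ring j d x"
    \<comment> \<open>Seen from its second cell, the ring starts with a step of dimension \<open>d\<close>.\<close>
    have shift: "ring d j ?z m = ?r (Suc m)" for m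
      by (induction m) (auto simp: ring_Suc)
    define ks where "ks = (!) [k1, k2, k3]"
    have ks: "ks 0 = k1" "ks 1 = k2" "ks 2 = k3" by (simp_all add: ks_def)
    have "linked (?E - F) (\<Union>m<3. level j (fst (ring d j ?z (2 * m)) j)) (\<Sum>m<3. ks m)
        (?z, g (Suc 0)) (ring d j ?z (2 * 3 - 1), g (Suc (2 * 3 - 1)))"
    proof (rule linked_ring_segments[OF ne(1), where g = "\<lambda>m. g (Suc m)"])
      fix m :: nat assume m: "m < 3"
      then have "m = 0 \<or> m = 1 \<or> m = 2" by auto
      then have "ks m = 2 \<or> even (ks m) \<and> 6 \<le> ks m \<and> ks m \<le> M" using k(6) ks by auto
      moreover have "{(ring d j ?z (2 * m), g (Suc (2 * m))),
          (nb d (ring d j ?z (2 * m)), g (Suc (2 * m + 1)))} \<notin> F"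
        using g[of "Suc (2 * m)"] m unfolding shift by (simp add: walk_edge_def ring_Suc)
      ultimately have "linked (dim_edges D - F) (level j (fst (ring d j ?z (2 * m)) j)) (ks m)
          (ring d j ?z (2 * m), g (Suc (2 * m))) (nb d (ring d j ?z (2 * m)), g (Suc (2 * m + 1)))"
        using segment[OF IH t(2) j] unfolding M_def by blast
      then show "linked (?E - F) (level j (fst (ring d j ?z (2 * m)) j)) (ks m)
          (ring d j ?z (2 * m), g (Suc (2 * m))) (ring d j ?z (2 * m + 1), g (Suc (2 * m + 1)))"
        unfolding ring_pair(1) using sub by (rule linked_mono) simp
    next
      fix m :: nat assume "Suc m < 3"
      then show "walk_edge (ring d j ?z) (2 * m + 1) (g (Suc (2 * m + 1))) (g (Suc (2 * m + 2))) \<notin> F"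
        using g[of "Suc (2 * m + 1)"] by (simp add: walk_edge_def shift)
    qed simp_all
    then have mid: "linked (?E - F) (\<Union>m<3. level j (fst (ring d j ?z (2 * m)) j)) (k1 + k2 + k3)
        (?z, g 1) (?r 6, g 6)"
      by (simp add: shift ks_def eval_nat_numeral)
    have disj: "level j (fst y j) \<inter> (\<Union>m<3. level j (fst (ring d j ?z (2 * m)) j)) = {}"
    proof -
      have "fst (ring d j ?z (2 * m)) j \<noteq> fst y j" if "m < 3" for m
      proof -
        have "(of_nat (Suc m) :: 4) \<noteq> of_nat 0" using of_nat_4_inject[of "Suc m" 0] that by auto
        then show ?thesis unfolding shift using xj by (auto simp: fst_ring[OF ne(2)] add_eq_0_iff)
      qed
      then have "level j (fst y j) \<inter> level j (fst (ring d j ?z (2 * m)) j) = {}" if "m < 3" for m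
        using that by (metis level_disjoint)
      then show ?thesis by blast
    qed
    have "{p ! t, (?z, g 1)} \<in> ?E - F" "{(?r 6, g 6), p ! Suc t} \<in> ?E - F"
    proof -
      have "walk_edge ?r 0 (g 0) (g 1) \<in> ?E - F" "walk_edge ?r 6 (g 6) (g 7) \<in> ?E - F"
        using g[of 0] g[of 6] by (simp_all add: ring_def)
      moreover have "?r 7 = nb d x" using ring_7[OF ne(2)] .
      ultimately show "{p ! t, (?z, g 1)} \<in> ?E - F" "{(?r 6, g 6), p ! Suc t} \<in> ?E - F"
        using t(3-6) by (simp_all add: walk_edge_def ring_Suc)
    qed
    moreover have "path (?E - F) p"
      using p(2) sub unfolding path_def by (auto elim: successively_mono)
    ultimately have "linked (?E - F) (level j (fst y j) \<union> (\<Union>m<3. level j (fst (ring d j ?z (2 * m)) j)))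
        (length p + (k1 + k2 + k3)) (hd p) (last p)"
      using linked_insert[OF _ p(6) t(1) mid disj] by blast
    then show ?thesis using p(3-5) k(1) by (auto elim!: linked_mono simp: add.assoc)
  qed
qed

section \<open>Induction on the dimensions\<close>

lemma dim_edges_UN: "dim_edges D = (\<Union>j\<in>D. dim_edges {j})"
proof -
  have "\<exists>j\<in>D. f \<in> dim_edges {j}" if f: "f \<in> dim_edges D" for f
  proof -
    obtain j y b b' where "j \<in> D" "f = {(y, b), (nb j y, b')}"
      using f unfolding dim_edges_def by blast
    then show ?thesis by auto
  qed
  moreover have "dim_edges {j} \<subseteq> dim_edges D" if "j \<in> D" for j
    using that by (intro dim_edges_mono) simp
  ultimately show ?thesis by blast
qed

text \<open>
  Otherwise the other dimensions always carry at least \<open>2 card D - 3\<close> faults, so each dimension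
  carries at most one fault, and there are at most \<open>card D\<close> faults. If some dimension carries
  one, at most \<open>card D - 1 < 2 card D - 3\<close> are left for the others; if none does, there are no
  faults at all.
\<close>

lemma light_dimension:
  assumes fin: "finite F" "finite D" and n: "3 \<le> card D"
    and X: "card (F \<inter> dim_edges D) \<le> 2 * card D - 2"
  shows "\<exists>j \<in> D. card (F \<inter> dim_edges (D - {j})) \<le> 2 * card D - 4"
proof (rule ccontr)
  assume "\<not> ?thesis"
  then have big: "2 * card D - 3 \<le> card (F \<inter> dim_edges (D - {j}))" if "j \<in> D" for j
    using that by (auto simp: not_le)
  let ?Y = "\<lambda>j. F \<inter> dim_edges {j}"
  have disj: "dim_edges A \<inter> dim_edges B = {}" if "A \<inter> B = {}" for A B
  proof -
    have "f \<notin> dim_edges B" if "f \<in> dim_edges A" for f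
    proof -
      obtain i y b b' where "i \<in> A" "f = {(y, b), (nb i y, b')}"
        using \<open>f \<in> dim_edges A\<close> unfolding dim_edges_def by blast
      then show ?thesis using \<open>A \<inter> B = {}\<close> by auto
    qed
    then show ?thesis by blast
  qed
  have un: "dim_edges (A \<union> B) = dim_edges A \<union> dim_edges B" for A B
    unfolding dim_edges_UN[of "A \<union> B"] dim_edges_UN[of A] dim_edges_UN[of B] by blast
  have split: "card (F \<inter> dim_edges D) = card (?Y j) + card (F \<inter> dim_edges (D - {j}))" if "j \<in> D" for j
  proof -
    have "F \<inter> dim_edges D = ?Y j \<union> (F \<inter> dim_edges (D - {j}))"
      using un[of "{j}" "D - {j}"] that by (auto simp: insert_absorb)
    moreover have "?Y j \<inter> (F \<inter> dim_edges (D - {j})) = {}" using disj[of "{j}" "D - {j}"] by blast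
    ultimately show ?thesis using fin(1) by (simp add: card_Un_disjoint)
  qed
  have "(\<Sum>j\<in>D. card (?Y j)) = card (\<Union>j\<in>D. ?Y j)"
  proof (intro card_UN_disjoint[symmetric] ballI impI)
    fix i j assume "i \<in> D" "j \<in> D" "i \<noteq> j"
    then show "?Y i \<inter> ?Y j = {}" using disj[of "{i}" "{j}"] by blast
  qed (use fin in simp_all)
  also have "(\<Union>j\<in>D. ?Y j) = F \<inter> dim_edges D"
    unfolding dim_edges_UN[of D] by blast
  finally have total: "(\<Sum>j\<in>D. card (?Y j)) = card (F \<inter> dim_edges D)" .
  moreover have "card (?Y j) \<le> 1" if "j \<in> D" for j
    using split[OF that] big[OF that] X n by linarith
  ultimately have le: "card (F \<inter> dim_edges D) \<le> card D"
    using sum_mono[of D "\<lambda>j. card (?Y j)" "\<lambda>_. 1"] by simp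
  obtain j where "j \<in> D" "card (F \<inter> dim_edges D) = 0 \<or> 0 < card (?Y j)"
  proof (cases "\<exists>j \<in> D. 0 < card (?Y j)")
    case True
    then show ?thesis using that by blast
  next
    case False
    then have "card (F \<inter> dim_edges D) = 0" using total by simp
    moreover have "D \<noteq> {}" using n by auto
    ultimately show ?thesis using that by blast
  qed
  then show False using split[of j] big[of j] le n by linarith
qed

theorem spans_of_few_faults:
  assumes "finite F" "finite D" "2 \<le> card D" "card (F \<inter> dim_edges D) \<le> 2 * card D - 2"
  shows "spans D F"
  using assms(2-4)
proof (induction "card D" arbitrary: D rule: less_induct)
  case less
  show ?case
  proof (cases "card D = 2")
    case True
    then show ?thesis using spans_two[OF assms(1) True] less.prems by simp
  next
    case False
    then have n: "3 \<le> card D" using less.prems(2) by linarith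
    obtain j where j: "j \<in> D" "card (F \<inter> dim_edges (D - {j})) \<le> 2 * card D - 4"
      using light_dimension[OF assms(1) less.prems(1) n less.prems(3)] by blast
    let ?D = "D - {j}"
    have c: "card D = Suc (card ?D)" using card.remove[OF less.prems(1) j(1)] .
    have D: "insert j ?D = D" using j(1) by blast
    have IH: "spans ?D F" using less.hyps[of ?D] less.prems(1) j(2) n c by simp
    have X: "card (F \<inter> dim_edges (insert j ?D)) \<le> 2 * card ?D"
      and Y: "card (F \<inter> dim_edges ?D) < 2 * card ?D" and D2: "2 \<le> card ?D"
      using less.prems(3) j(2) n c unfolding D by linarith+
    have finD: "finite ?D" using less.prems(1) by simp
    have jD: "j \<notin> ?D" by simp
    show ?thesis
      unfolding spans_def
    proof (intro ballI allI impI)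
      fix i y b b' and l :: nat
      assume i: "i \<in> D" and l: "even l \<and> 6 \<le> l \<and> l \<le> 4 ^ card D"
      show "linked (dim_edges D - F) UNIV l (y, b) (nb i y, b')"
      proof (cases "i = j")
        case True
        then show ?thesis
          using linked_across[OF assms(1) finD jD D2 IH X Y, unfolded D] l by blast
      next
        case False
        then show ?thesis
          using linked_along[OF assms(1) finD jD D2 IH X, unfolded D] i l by blast
      qed
    qed
  qed
qed

section \<open>The balanced hypercube in terms of cells\<close>

text \<open>
  The coordinate 0 of the position is chosen such that the coordinate sum is 0 or 1 according to
  the parity of \<open>a\<^sub>0\<close>. A neighbour that changes only \<open>a\<^sub>0\<close> thereby becomes a step in the dimension
  0.
\<close>

definition encode :: "nat \<Rightarrow> int list \<Rightarrow> vertex" where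
  "encode n a = ((\<lambda>i. if i = 0 then of_int (a ! 0 mod 2) - (\<Sum>k = 1..<n. of_int (a ! k))
      else if i < n then of_int (a ! i) else 0, odd (a ! 0)), a ! 0 \<ge> 2)"

lemma of_int_4_inject:
  assumes "0 \<le> a" "a \<le> 3" "0 \<le> b" "b \<le> 3" "of_int a = (of_int b :: 4)"
  shows "a = b"
proof -
  have "a \<in> {0, 1, 2, 3}" "b \<in> {0, 1, 2, 3}" using assms(1-4) by auto
  then show ?thesis using assms(5) by auto
qed

lemma BH_vertex_nth: "a \<in> BH_vertices n \<Longrightarrow> i < n \<Longrightarrow> 0 \<le> a ! i \<and> a ! i \<le> 3"
  unfolding BH_vertices_def by (auto dest!: nth_mem)

lemma inj_on_encode: "inj_on (encode n) (BH_vertices n)"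
proof (rule inj_onI)
  fix a b assume ab: "a \<in> BH_vertices n" "b \<in> BH_vertices n" "encode n a = encode n b"
  have len: "length a = n" "length b = n" using ab by (auto simp: BH_vertices_def)
  show "a = b"
  proof (rule nth_equalityI)
    fix i assume i: "i < length a"
    note r = BH_vertex_nth[OF ab(1), of i] BH_vertex_nth[OF ab(2), of i]
    show "a ! i = b ! i"
    proof (cases "i = 0")
      case True
      have "odd (a ! 0) = odd (b ! 0)" "(a ! 0 \<ge> 2) = (b ! 0 \<ge> 2)"
        using ab(3) by (auto simp: encode_def)
      moreover have "0 \<le> a ! 0" "a ! 0 \<le> 3" "0 \<le> b ! 0" "b ! 0 \<le> 3" using r i len True by auto
      ultimately have "a ! 0 = b ! 0" by presburger
      then show ?thesis using True by simp
    next
      case False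
      have "fst (fst (encode n a)) i = fst (fst (encode n b)) i" using ab(3) by simp
      then have "(of_int (a ! i) :: 4) = of_int (b ! i)" using False i len by (simp add: encode_def)
      then show ?thesis using r i len by (intro of_int_4_inject) auto
    qed
  qed (use len in simp)
qed

lemma of_int_mod_4 [simp]: "of_int (k mod 4) = (of_int k :: 4)"
proof -
  have "(of_int k :: 4) = of_int (4 * (k div 4) + k mod 4)" by simp
  also have "\<dots> = 4 * of_int (k div 4) + of_int (k mod 4)" by (simp only: of_int_add of_int_mult of_int_numeral)
  also have "(4 :: 4) = 0" by simp
  finally show ?thesis by (simp only: mult_zero_left add_0)
qed

text \<open>
  The two families of neighbours in a uniform notation, where \<open>i = 0\<close> stands for changing \<open>a\<^sub>0\<close>
  only.
\<close>

definition BH_step :: "int list \<Rightarrow> int \<Rightarrow> nat \<Rightarrow> int list" where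
  "BH_step a s i = (if i = 0 then a[0 := (a ! 0 + s) mod 4]
     else a[0 := (a ! 0 + s) mod 4, i := (a ! i + (- 1) ^ nat (a ! 0)) mod 4])"

lemma BH_neighbours_conv:
  assumes "n \<ge> 1"
  shows "BH_neighbours n a = {BH_step a s i | s i. s \<in> {1, - 1} \<and> i < n}"
proof (intro equalityI subsetI)
  fix x assume "x \<in> BH_neighbours n a"
  then consider s where "s \<in> {1, - 1}" "x = BH_step a s 0"
    | s i where "s \<in> {1, - 1}" "1 \<le> i" "i \<le> n - 1" "x = BH_step a s i"
    unfolding BH_neighbours_def BH_step_def by auto
  then show "x \<in> {BH_step a s i | s i. s \<in> {1, - 1} \<and> i < n}"
  proof cases
    case 1
    moreover have "0 < n" using assms by simp
    ultimately show ?thesis by blast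
  next
    case 2
    moreover from this have "i < n" by simp
    ultimately show ?thesis by blast
  qed
next
  fix x assume "x \<in> {BH_step a s i | s i. s \<in> {1, - 1} \<and> i < n}"
  then obtain s i where x: "x = BH_step a s i" "s \<in> {1, - 1}" "i < n" by blast
  show "x \<in> BH_neighbours n a"
  proof (cases "i = 0")
    case True
    then have "x = a[0 := (a ! 0 + s) mod 4]" using x(1) by (simp add: BH_step_def)
    then show ?thesis using x(2) unfolding BH_neighbours_def by blast
  next
    case False
    then have "x = a[0 := (a ! 0 + s) mod 4, i := (a ! i + (- 1) ^ nat (a ! 0)) mod 4]"
      using x(1) by (simp add: BH_step_def)
    moreover have "1 \<le> i \<and> i \<le> n - 1" using False x(3) by simp
    ultimately show ?thesis using x(2) unfolding BH_neighbours_def by blast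
  qed
qed

lemma BH_step_in_vertices:
  assumes "a \<in> BH_vertices n"
  shows "BH_step a s i \<in> BH_vertices n"
proof -
  have "0 \<le> k mod 4 \<and> k mod 4 \<le> (3::int)" for k by presburger
  then show ?thesis
    using assms unfolding BH_vertices_def BH_step_def
    by (auto dest!: set_update_subset_insert[THEN subsetD])
qed

lemma encode_BH_step:
  assumes a: "a \<in> BH_vertices n" and i: "i < n" and s: "s = 1 \<or> s = - 1"
  shows "encode n (BH_step a s i) = (nb i (fst (encode n a)), (a ! 0 + s) mod 4 \<ge> 2)"
proof -
  have len: "length a = n" using a by (simp add: BH_vertices_def)
  have a0: "0 \<le> a ! 0" using BH_vertex_nth[OF a, of 0] i by auto
  have first: "BH_step a s i ! 0 = (a ! 0 + s) mod 4"
    using len i by (auto simp: BH_step_def)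
  have odd: "odd ((a ! 0 + s) mod 4) = even (a ! 0)" using s by presburger
  have pow: "((- 1) ^ nat (a ! 0) :: 4) = (if odd (a ! 0) then - 1 else 1)"
    using a0 by (simp add: even_nat_iff minus_one_power_iff)
  have rest: "of_int (BH_step a s i ! k) = (of_int (a ! k) :: 4)
      + (if k = i then (if odd (a ! 0) then - 1 else 1) else 0)" if "1 \<le> k" "k < n" for k
    using that len i by (auto simp: BH_step_def nth_list_update pow)
  have sum: "(\<Sum>k = 1..<n. of_int (BH_step a s i ! k)) = (\<Sum>k = 1..<n. of_int (a ! k) :: 4)
      + (if i = 0 then 0 else if odd (a ! 0) then - 1 else 1)"
  proof -
    have "(\<Sum>k = 1..<n. of_int (BH_step a s i ! k)) = (\<Sum>k = 1..<n. (of_int (a ! k) :: 4)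
      + (if k = i then (if odd (a ! 0) then - 1 else 1) else 0))"
      using rest by (intro sum.cong) auto
    then show ?thesis using i by (simp add: sum.distrib)
  qed
  have mod2: "(of_int ((a ! 0 + s) mod 4 mod 2) :: 4) = (if odd (a ! 0) then 0 else 1)"
    using odd by (simp add: mod_2_eq_odd)
  have mod2': "(of_int (a ! 0 mod 2) :: 4) = (if odd (a ! 0) then 1 else 0)"
    by (simp add: mod_2_eq_odd)
  have "fst (encode n (BH_step a s i)) = nb i (fst (encode n a))"
  proof (rule cell_eqI)
    fix k
    show "fst (fst (encode n (BH_step a s i))) k = fst (nb i (fst (encode n a))) k"
    proof (cases "k = 0")
      case True
      then show ?thesis
        by (simp add: encode_def first sum mod2 mod2' del: One_nat_def)
    next
      case False
      then show ?thesis using rest[of k] i by (cases "k < n") (auto simp: encode_def)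
    qed
  qed (simp add: encode_def first odd)
  then show ?thesis by (simp add: prod_eq_iff encode_def first)
qed

text \<open>
  The signs \<open>s = 1\<close> and \<open>s = - 1\<close> lead to the two twins of the neighbouring cell.
\<close>

lemma encode_neighbour:
  assumes a: "a \<in> BH_vertices n" and i: "i < n"
  shows "\<exists>b \<in> BH_vertices n \<inter> BH_neighbours n a. encode n b = (nb i (fst (encode n a)), c)"
proof -
  have "0 \<le> a ! 0" "a ! 0 \<le> 3" using BH_vertex_nth[OF a, of 0] i by auto
  then have "((a ! 0 + 1) mod 4 \<ge> 2) \<noteq> ((a ! 0 + - 1) mod 4 \<ge> 2)" by presburger
  then obtain s where s: "s = 1 \<or> s = - 1" "((a ! 0 + s) mod 4 \<ge> 2) = c" by metis
  have "BH_step a s i \<in> BH_neighbours n a"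
    using s(1) i BH_neighbours_conv[of n a] by auto
  then show ?thesis
    using BH_step_in_vertices[OF a, of s i] encode_BH_step[OF a i s(1)] s(2) by auto
qed

lemma BH_edge_encode:
  assumes "n \<ge> 1" "a \<in> BH_vertices n" "b \<in> BH_neighbours n a"
  obtains i c where "i < n" "encode n b = (nb i (fst (encode n a)), c)" "b \<in> BH_vertices n"
proof -
  obtain s i where "b = BH_step a s i" "s = 1 \<or> s = - 1" "i < n"
    using assms(3) unfolding BH_neighbours_conv[OF assms(1)] by auto
  then show ?thesis
    using that encode_BH_step[OF assms(2)] BH_step_in_vertices[OF assms(2)] by metis
qed

text \<open>
  The image of \<open>encode\<close> is closed under neighbours in the dimensions below \<open>n\<close>, so a path that
  starts in it stays in it.
\<close>

lemma path_decode:
  assumes "successively (\<lambda>u v. {u, v} \<in> dim_edges {..<n}) p" "p \<noteq> []" "hd p \<in> encode n ` BH_vertices n"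
  shows "\<exists>q. p = map (encode n) q \<and> set q \<subseteq> BH_vertices n \<and> successively (\<lambda>a b. {a, b} \<in> edges (BH n)) q"
  using assms
proof (induction p)
  case (Cons u p)
  then obtain a where a: "a \<in> BH_vertices n" "u = encode n a" by auto
  show ?case
  proof (cases p)
    case Nil
    then show ?thesis using a by (intro exI[of _ "[a]"]) auto
  next
    case (Cons v p')
    have uv: "{u, v} \<in> dim_edges {..<n}" "successively (\<lambda>u v. {u, v} \<in> dim_edges {..<n}) p"
      using Cons.prems(1) Cons by auto
    then obtain i c where i: "i < n" "v = (nb i (fst u), c)" by (elim dim_edgeE) auto
    then obtain b where b: "b \<in> BH_vertices n" "b \<in> BH_neighbours n a" "v = encode n b"
      using encode_neighbour[OF a(1) i(1), of c] i(2) a(2) by auto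
    have "p \<noteq> []" "hd p \<in> encode n ` BH_vertices n" using Cons b by auto
    then obtain q where q: "p = map (encode n) q" "set q \<subseteq> BH_vertices n"
      "successively (\<lambda>a b. {a, b} \<in> edges (BH n)) q"
      using Cons.IH[OF uv(2)] by blast
    have "q \<noteq> []" "encode n (hd q) = encode n b" using q(1) b(3) Cons by auto
    then have "hd q = b" using inj_onD[OF inj_on_encode] q(2) b(1) by (metis list.set_sel(1) subsetD)
    moreover have "{a, b} \<in> edges (BH n)" using a(1) b(2) by (auto simp: BH_def)
    ultimately show ?thesis
      using a q \<open>q \<noteq> []\<close> by (intro exI[of _ "a # q"]) (auto simp: successively_Cons)
  qed
qed simp

lemma finite_BH_edges: "n \<ge> 1 \<Longrightarrow> finite (edges (BH n))"
proof -
  assume n: "n \<ge> 1"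
  have "BH_vertices n = {a. set a \<subseteq> {0..3} \<and> length a = n}" by (auto simp: BH_vertices_def)
  then have "finite (BH_vertices n)" by (simp add: finite_lists_length_eq)
  moreover have "f \<in> Pow (BH_vertices n)" if f: "f \<in> edges (BH n)" for f
  proof -
    obtain a b where ab: "f = {a, b}" "a \<in> BH_vertices n" "b \<in> BH_neighbours n a"
      using f by (auto simp: BH_def)
    obtain i c where "b \<in> BH_vertices n" using BH_edge_encode[OF n ab(2,3)] .
    then show ?thesis using ab by simp
  qed
  ultimately show ?thesis by (meson finite_Pow_iff finite_subset subsetI)
qed

theorem theorem3p2:
  fixes n :: nat
  assumes "n \<ge> 2"
  shows "\<forall>F e l. F \<subseteq> edges (BH n) \<and> card F \<le> 2 * n - 2
           \<and> e \<in> edges (BH n) - F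
           \<and> even l \<and> 6 \<le> l \<and> l \<le> 2 ^ (2 * n)
         \<longrightarrow> (\<exists>c. is_cycle (delete_edges (BH n) F) c \<and> length c = l \<and> e \<in> cycle_edges c)"
proof (intro allI impI)
  fix F :: "int list set set" and e :: "int list set" and l :: nat
  assume h: "F \<subseteq> edges (BH n) \<and> card F \<le> 2 * n - 2 \<and> e \<in> edges (BH n) - F
           \<and> even l \<and> 6 \<le> l \<and> l \<le> 2 ^ (2 * n)"
  have n: "n \<ge> 1" using assms by simp
  obtain a b where ab: "a \<in> BH_vertices n" "b \<in> BH_neighbours n a" "e = {a, b}"
    using h by (auto simp: BH_def)
  obtain i c where i: "i < n" "encode n b = (nb i (fst (encode n a)), c)" "b \<in> BH_vertices n"
    using BH_edge_encode[OF n ab(1,2)] .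
  let ?F = "(`) (encode n) ` F" and ?D = "{..<n}"
  have finF: "finite F" using h finite_BH_edges[OF n] by (meson finite_subset)
  have "card (?F \<inter> dim_edges ?D) \<le> card ?F" using finF by (intro card_mono) auto
  also have "\<dots> \<le> card F" using finF by (rule card_image_le)
  finally have "card (?F \<inter> dim_edges ?D) \<le> 2 * card ?D - 2" using h by simp
  then have "spans ?D ?F" using finF assms by (intro spans_of_few_faults) auto
  moreover have "l \<le> 4 ^ card ?D" using h by (simp add: power_mult)
  ultimately have "linked (dim_edges ?D - ?F) UNIV l (fst (encode n a), snd (encode n a)) (nb i (fst (encode n a)), c)"
    using h i(1) unfolding spans_def by blast
  then obtain p where p: "p \<noteq> []" "path (dim_edges ?D - ?F) p" "hd p = encode n a"
    "last p = encode n b" "length p = l"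
    unfolding linked_def i(2) by auto
  have "successively (\<lambda>u v. {u, v} \<in> dim_edges ?D) p"
    using p(2) unfolding path_def by (auto elim: successively_mono)
  then obtain q where q: "p = map (encode n) q" "set q \<subseteq> BH_vertices n"
    "successively (\<lambda>a b. {a, b} \<in> edges (BH n)) q"
    using path_decode[of n p] p(1,3) ab(1) by blast
  have l: "length q = l" "q \<noteq> []" using p q by auto
  have "encode n (hd q) = encode n a" "encode n (last q) = encode n b"
    using p(3,4) q(1) l(2) by (simp_all add: hd_map last_map)
  then have ends: "hd q = a" "last q = b"
    using inj_onD[OF inj_on_encode] q(2) l(2) ab(1) i(3) by (metis list.set_sel(1) last_in_set subsetD)+
  have last: "{q ! k, q ! (Suc k mod length q)} = e" if "Suc k = length q" for k
  proof -
    have "q ! k = b" "q ! 0 = a"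
      using that ends last_conv_nth[OF l(2)] hd_conv_nth[OF l(2)] by (metis diff_Suc_1)+
    then show ?thesis using that ab(3) by auto
  qed
  have inner: "{q ! k, q ! Suc k} \<in> edges (BH n) - F" if "Suc k < length q" for k
  proof -
    have "{p ! k, p ! Suc k} \<in> dim_edges ?D - ?F"
      using p(2) that q(1) by (auto simp: path_def successively_conv_nth)
    moreover have "{p ! k, p ! Suc k} = encode n ` {q ! k, q ! Suc k}" using that q(1) by simp
    ultimately have "{q ! k, q ! Suc k} \<notin> F" by blast
    then show ?thesis using q(3) that by (auto simp: successively_conv_nth)
  qed
  have "{q ! k, q ! (Suc k mod length q)} \<in> edges (BH n) - F" if "k < length q" for k
  proof (cases "Suc k = length q")
    case True
    then show ?thesis using last h by metis
  next
    case False
    then show ?thesis using inner[of k] that by simp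
  qed
  then have "cycle_edges q \<subseteq> edges (BH n) - F" unfolding cycle_edges_def by blast
  moreover have "distinct q" using p(2) q(1) by (auto simp: path_def distinct_map)
  moreover have "set q \<subseteq> vertices (BH n)" using q(2) by (simp add: BH_def)
  moreover have "3 \<le> length q" using l h by simp
  ultimately have "is_cycle (delete_edges (BH n) F) q"
    unfolding is_cycle_def delete_edges_def by simp
  moreover have "e \<in> cycle_edges q"
  proof -
    obtain k where "Suc k = length q" using l(2) by (cases q) auto
    then show ?thesis using last[of k] unfolding cycle_edges_def by (metis (mono_tags, lifting) lessI mem_Collect_eq)
  qed
  ultimately show "\<exists>c. is_cycle (delete_edges (BH n) F) c \<and> length c = l \<and> e \<in> cycle_edges c"
    using l(1) by blast
qed

end
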